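(* Let $s_0 \ge 0$ and $s_j > 0$ for $j \ge 1$. For every $k > 0$, $$ M[s_k](x) = \frac{1}{s_k} \quad \text{for every } x\in[0,\infty), $$ and, for every $0 \le j < k$ and $x \in [0,\infty)$, $$ M [ s_j, \ldots,s_{k} ] (x) = \frac{M^{\ast}[s_{j+1},\ldots,s_{k}](t)}{1+ s_j\, M^{\ast}[s_{j+1},\ldots,s_{k}](t)}, $$ where $t$ is related to $x$ by $$ x = \int_0^t \left \{ 1+ s_j \,M^{\ast}[s_{j+1},\ldots,s_{k}](\tau) \right \}^2\,d \tau . $$ Precisely, $t = \inf\{ t' \ge 0 : X(t') > x\}$, where $X(t') := \int_0^{t'} \{1+s_j M^\ast[s_{j+1},\ldots,s_k](\tau)\}^2\,d\tau \in [0,\infty]$, with the conventions $0\cdot\infty = 0$, $\frac{\infty}{1+s\cdot\infty} = \frac1s$ if $s>0$, and $\frac{\infty}{1+s\cdot\infty}=\infty$ if $s=0$.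
   Context: ${\mathbb M}$ is the set of functions $M : [0,\infty] \to [0,\infty]$ that are non-decreasing, right-continuous and satisfy $M(\infty)=\infty$; elements of ${\mathbb M}$ are called strings. By convention $M(0-)=0$, so that $dM$ includes an atom of mass $M(0)$ at $0$. Put $L := \sup\{x\in[0,\infty) : M(x)<\infty\}$ (with $\sup\emptyset=0$). Characteristic function. For $z<0$ let $\varphi(\cdot,z)$ and $\psi(\cdot,z)$ be the solutions on $[0,L)$ of the string equation $y''+zM'y=0$ with $\varphi(0,z)=1$, $\varphi'(0-,z)=0$ and $\psi(0,z)=0$, $\psi'(0-,z)=1$; i.e. $$ \varphi(x,z) = 1 - z\int_{[0,x]} (x-t)\varphi(t,z)\,dM(t), \qquad \psi(x,z) = x - z\int_{[0,x]} (x-t)\psi(t,z)\,dM(t). $$ The characteristic function of $M$ is $W(z) := \lim_{x\to L-} \psi(x,z)/\varphi(x,z)$ for $z<0$ (with $W\equiv0$ if $L=0$), extended to ${\mathbb C}\setminus[0,\infty)$ by analytic continuation. By a known theorem conjectured by Krein, $M\mapsto W$ is a bijection from ${\mathbb M}$ onto the set ${\mathbb W}$ of functions $W(z) = c + \int_{[0,\infty)} \frac{d\sigma(\lambda)}{\lambda-z}$ with $c\ge0$ and $\sigma$ right-continuous non-decreasing with support in $[0,\infty)$ and $\int_{[0,\infty)}\frac{d\sigma(\lambda)}{1+\lambda}<\infty$ (the degenerate function $W\equiv\infty$, corresponding to $M\equiv 0$ on $[0,\infty)$, being included). The dual of a string $M$ is its right-continuous inverse $M^\ast(x) := \inf\{t\ge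 0 : M(t) > x\}$ for $x<\infty$, $M^\ast(\infty):=\infty$. Finite continued fractions. With $s_0\ge0$ and $s_i>0$ for $i\geq 1$, define $W[s_j] := \frac{s_j}{-z}$ and, more generally, $$ W[s_j,\ldots,s_{j+2 k}] := \frac{s_j}{-z} + \frac{1}{\displaystyle s_{j+1}+ \frac{1}{\displaystyle \frac{s_{j+2}}{-z}+ \cdots + \frac{1}{\displaystyle s_{j+2k-1}+ \frac{1}{\displaystyle \frac{s_{j+2k}}{-z}}}}} $$ and $$ W[s_j,\ldots,s_{j+2k+1}] := \frac{s_j}{-z} + \frac{1}{\displaystyle s_{j+1}+ \frac{1}{\displaystyle \frac{s_{j+2}}{-z}+ \cdots + \frac{1}{\displaystyle s_{j+2k-1}+ \frac{1}{\displaystyle \frac{s_{j+2k}}{-z}+\frac{1}{\displaystyle s_{j+2k+1}}}}}} , $$ so that terms of the form $\frac{s_i}{-z}$ and $s_i$ alternate, starting with $\frac{s_j}{-z}$, whatever the parity of $j$ (e.g. $W[s_j,s_{j+1}] = \frac{s_j}{-z}+\frac{1}{s_{j+1}}$). These functions belong to ${\mathbb W}$. $M[s_j,\ldots,s_k]$ denotes the string with characteristic function $W[s_j,\ldots,s_k]$, and $M^\ast[s_j,\ldots,s_k]$ its dual string. *)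

theory Defs
  imports "HOL-Analysis.Analysis"
begin

definition krein_string :: "(ennreal \<Rightarrow> ennreal) \<Rightarrow> bool" where
  "krein_string M \<longleftrightarrow> mono M \<and> (\<forall>x. continuous (at_right x) M) \<and> M \<infinity> = \<infinity>"

definition string_length :: "(ennreal \<Rightarrow> ennreal) \<Rightarrow> ennreal" where
  "string_length M = Sup {x. x < \<infinity> \<and> M x < \<infinity>}"

text \<open>The measure \<open>dM\<close> on \<open>[0,x]\<close>, for \<open>x\<close> below the length of \<open>M\<close>. Freezing \<open>M\<close> beyond \<open>x\<close>
  keeps the distribution function finite; setting it to \<open>0\<close> on the negative half-line produces the
  atom of mass \<open>M 0\<close> at \<open>0\<close>.\<close>

definition string_measure :: "(ennreal \<Rightarrow> ennreal) \<Rightarrow> real \<Rightarrow> real measure" where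
  "string_measure M x =
     interval_measure (\<lambda>t. if t < 0 then 0 else enn2real (M (ennreal (min t x))))"

text \<open>\<open>u\<close> solves \<open>y'' + z M' y = 0\<close> on \<open>[0,L)\<close> with \<open>y(0) = a\<close> and \<open>y'(0-) = b\<close>. Integrability is
  required explicitly because the Bochner integral of a non-integrable function is \<open>0\<close>. The values
  of \<open>u\<close> outside \<open>[0,L)\<close> are irrelevant.\<close>

definition string_solution ::
  "(ennreal \<Rightarrow> ennreal) \<Rightarrow> real \<Rightarrow> real \<Rightarrow> real \<Rightarrow> (real \<Rightarrow> real) \<Rightarrow> bool" where
  "string_solution M z a b u \<longleftrightarrow>
     (\<forall>x\<ge>0. ennreal x < string_length M \<longrightarrow>
        set_integrable (string_measure M x) {0..x} (\<lambda>t. (x - t) * u t) \<and>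
        u x = a + b * x - z * (LINT t:{0..x}|string_measure M x. (x - t) * u t))"

definition left_limit_filter :: "ennreal \<Rightarrow> real filter" where
  "left_limit_filter L = (if L = \<infinity> then at_top else at_left (enn2real L))"

text \<open>\<open>W\<close> is the characteristic function of \<open>M\<close>: it is analytic off \<open>[0,\<infinity>)\<close> and its values on
  the negative half-line are \<open>lim \<psi>/\<phi>\<close>. Values of \<open>W\<close> on \<open>[0,\<infinity>)\<close> are unconstrained. The string
  vanishing on all of \<open>[0,\<infinity>)\<close>, for which the limit is \<open>\<infinity>\<close>, has no characteristic function
  in this (complex-valued) sense.\<close>

definition has_characteristic_function ::
  "(ennreal \<Rightarrow> ennreal) \<Rightarrow> (complex \<Rightarrow> complex) \<Rightarrow> bool" where
  "has_characteristic_function M W \<longleftrightarrow>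
     W holomorphic_on (- (complex_of_real ` {0..})) \<and>
     (\<forall>z<0. if string_length M = 0 then W (complex_of_real z) = 0
        else \<exists>\<phi> \<psi>. string_solution M z 1 0 \<phi> \<and> string_solution M z 0 1 \<psi> \<and>
               ((\<lambda>x. complex_of_real (\<psi> x / \<phi> x)) \<longlongrightarrow> W (complex_of_real z))
                 (left_limit_filter (string_length M)))"

definition dual_string :: "(ennreal \<Rightarrow> ennreal) \<Rightarrow> ennreal \<Rightarrow> ennreal" where
  "dual_string M x = (if x = \<infinity> then \<infinity> else Inf {t. M t > x})"

fun cont_frac :: "real list \<Rightarrow> complex \<Rightarrow> complex" where
  "cont_frac [a] z = of_real a / (- z)"
| "cont_frac [a, b] z = of_real a / (- z) + 1 / of_real b"
| "cont_frac (a # b # c # cs) z =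
     of_real a / (- z) + 1 / (of_real b + 1 / cont_frac (c # cs) z)"

text \<open>The string with characteristic function \<open>W[s\<^sub>j, \<dots>, s\<^sub>k]\<close>.\<close>

definition cf_string :: "(nat \<Rightarrow> real) \<Rightarrow> nat \<Rightarrow> nat \<Rightarrow> ennreal \<Rightarrow> ennreal" where
  "cf_string s j k =
     (THE M. krein_string M \<and> has_characteristic_function M (cont_frac (map s [j..<Suc k])))"

text \<open>\<open>m / (1 + s m)\<close>. Division on \<^typ>\<open>ennreal\<close> has \<open>\<infinity> / \<infinity> = 0\<close>, hence the separate case.\<close>

definition string_fraction :: "real \<Rightarrow> ennreal \<Rightarrow> ennreal" where
  "string_fraction s m =
     (if m = \<infinity> then (if s = 0 then \<infinity> else ennreal (1 / s)) else m / (1 + ennreal s * m))"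

definition time_integral :: "real \<Rightarrow> (ennreal \<Rightarrow> ennreal) \<Rightarrow> real \<Rightarrow> ennreal" where
  "time_integral s N t' = (\<integral>\<^sup>+\<tau>\<in>{0..t'}. (1 + ennreal s * N (ennreal \<tau>))\<^sup>2 \<partial>lborel)"

definition time_change :: "real \<Rightarrow> (ennreal \<Rightarrow> ennreal) \<Rightarrow> real \<Rightarrow> ennreal" where
  "time_change s N x = Inf {ennreal t' | t'. t' \<ge> 0 \<and> time_integral s N t' > ennreal x}"

end

theory Submission
  imports Defs "HOL-Probability.Distribution_Functions"
begin

text \<open>
  Every string in the theorem consists of finitely many gaps and point masses, and both sides can be
  computed on the alternating list of their sizes. Write \<open>w(\<mu>)\<close> for the value of the characteristic
  function at \<open>-\<mu>\<close>. A gap \<open>l\<close> put in front of a string changes \<open>w\<close> to \<open>l + w\<close>, and a mass \<open>m\<close> put at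
  its origin changes \<open>w\<close> to \<open>1 / (\<mu> m + 1 / w)\<close> (lemmas \<open>characteristic_value_delay\<close> and
  \<open>characteristic_value_add_mass\<close>), so that \<open>w\<close> is a continued fraction in the gaps and masses.
  Passing to the dual string exchanges gaps and masses, that is, the same list is read with the
  opposite convention about its first entry, and \<open>w\<close> becomes \<open>1 / (\<mu> w)\<close>. The change of variables of
  the theorem multiplies a gap by \<open>p\<^sup>2\<close> and divides a mass by \<open>p p'\<close>, where \<open>p\<close> and \<open>p'\<close> are the values
  of \<open>1 + s N\<close> before and after the mass; an algebraic identity (\<open>bead_value_rescale\<close>) shows that \<open>w\<close>
  becomes \<open>w + s / \<mu>\<close>. Together, duality followed by the change of variables turns \<open>w\<close> into
  \<open>s / \<mu> + 1 / (\<mu> w)\<close>, and this is the recursion satisfied by the continued fractions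
  (\<open>cont_frac_Cons\<close>).

  It remains to see that no other string has the same characteristic function. For finite continued
  fractions this follows from the behaviour of \<open>w\<close> as \<open>\<mu> \<rightarrow> \<infinity>\<close>. If there is mass
  arbitrarily close to the origin, then \<open>w\<close> tends to \<open>0\<close>; hence the leading gap of any string is the
  limit of its \<open>w\<close>. If there is no atom at the origin and the length is positive, then \<open>\<mu> w\<close> tends to
  \<open>\<infinity>\<close>; hence the leading mass is the limit of \<open>1 / (\<mu> w)\<close>. So a string with the characteristic
  function of a list has the same first gap or mass as the list, both can be removed, and induction
  on the list applies (\<open>bead_string_unique\<close>). Both limits come from comparing \<open>\<psi>\<close> with a constant
  multiple of \<open>\<phi>\<close> directly in the integral equation.
\<close>

section \<open>Strings and their mass distributions\<close>

lemma right_continuous_iff_mono: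
  fixes M :: "ennreal \<Rightarrow> ennreal"
  assumes "mono M" "x < top"
  shows "continuous (at_right x) M \<longleftrightarrow> (\<forall>y>M x. \<exists>z>x. M z < y)"
proof
  assume "continuous (at_right x) M"
  then have "(M \<longlongrightarrow> M x) (at_right x)" by (simp add: continuous_within)
  then have "eventually (\<lambda>z. M z < y) (at_right x)" if "M x < y" for y
    using that by (rule order_tendstoD)
  then show "\<forall>y>M x. \<exists>z>x. M z < y"
    using eventually_at_right[OF \<open>x < top\<close>] by (metis dense)
next
  assume *: "\<forall>y>M x. \<exists>z>x. M z < y"
  have "(M \<longlongrightarrow> M x) (at_right x)"
  proof (rule order_tendstoI)
    fix y assume "y < M x"
    then show "eventually (\<lambda>z. y < M z) (at_right x)"
      using monoD[OF \<open>mono M\<close>] unfolding eventually_at_right[OF \<open>x < top\<close>]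
      by (metis assms(2) less_le_trans less_imp_le)
  next
    fix y assume "M x < y"
    then show "eventually (\<lambda>z. M z < y) (at_right x)"
      using * monoD[OF \<open>mono M\<close>] unfolding eventually_at_right[OF \<open>x < top\<close>]
      by (metis le_less_trans less_imp_le)
  qed
  then show "continuous (at_right x) M" by (simp add: continuous_within)
qed

text \<open>For monotone functions right-continuity is an order condition. In this form it is inherited
  without any limit arguments by all the strings that are built below. At \<open>\<infinity>\<close> the right
  neighbourhood filter is trivial, so continuity there is no condition.\<close>

lemma krein_string_iff:
  "krein_string M \<longleftrightarrow> mono M \<and> M \<infinity> = \<infinity> \<and> (\<forall>x<\<infinity>. \<forall>y>M x. \<exists>z>x. M z < y)"
proof -
  have "continuous (at_right (\<infinity>::ennreal)) M"
    unfolding infinity_ennreal_def trivial_limit_at_right_top by (rule continuous_bot)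
  then show ?thesis
    unfolding krein_string_def using right_continuous_iff_mono[of M]
    by (auto simp: less_top[symmetric]) (metis less_top)
qed

lemma krein_string_mono: "krein_string M \<Longrightarrow> x \<le> y \<Longrightarrow> M x \<le> M y"
  by (simp add: krein_string_iff mono_def)

text \<open>Right-continuity excludes a finite value at the supremum itself: finite mass at \<open>x\<close> leaves room
  for finite mass slightly beyond \<open>x\<close>.\<close>

lemma krein_string_finite_iff:
  assumes "krein_string M" "x < \<infinity>"
  shows "M x < \<infinity> \<longleftrightarrow> x < string_length M"
proof
  assume "M x < \<infinity>"
  then obtain z where "z > x" and z: "M z < \<infinity>"
    using assms unfolding krein_string_iff by blast
  obtain y where y: "x < y" "y < z"
    using dense[OF \<open>z > x\<close>] by blast
  have "M y < \<infinity>"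
    using krein_string_mono[OF assms(1), of y z] y(2) z by (metis le_less_trans less_imp_le)
  moreover have "y < \<infinity>"
    using y(2) by (metis infinity_ennreal_def less_le_trans top_greatest)
  ultimately have "y \<le> string_length M"
    unfolding string_length_def by (intro Sup_upper) simp
  then show "x < string_length M"
    using y(1) by (rule less_le_trans[rotated])
next
  assume "x < string_length M"
  then obtain y where "x < y" and y: "M y < \<infinity>"
    unfolding string_length_def less_Sup_iff by auto
  from \<open>x < y\<close> have "M x \<le> M y" by (intro krein_string_mono[OF assms(1)]) simp
  then show "M x < \<infinity>" using y by (rule le_less_trans)
qed

definition stopped_mass :: "(ennreal \<Rightarrow> ennreal) \<Rightarrow> real \<Rightarrow> real \<Rightarrow> real" where
  "stopped_mass M x t = (if t < 0 then 0 else enn2real (M (ennreal (min t x))))"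

lemma string_measure_altdef: "string_measure M x = interval_measure (stopped_mass M x)"
  by (simp add: string_measure_def stopped_mass_def[abs_def])

context
  fixes M :: "ennreal \<Rightarrow> ennreal" and x :: real
  assumes M: "krein_string M" and x: "x \<ge> 0" "ennreal x < string_length M"
begin

lemma mass_finite: "t \<le> x \<Longrightarrow> M (ennreal t) < \<infinity>"
  using krein_string_finite_iff[OF M, of "ennreal t"] x
  by (metis ennreal_leI ennreal_less_top infinity_ennreal_def le_less_trans)

lemma stopped_mass_mono: "s \<le> t \<Longrightarrow> stopped_mass M x s \<le> stopped_mass M x t"
  unfolding stopped_mass_def using mass_finite[of "min t x"] x
  by (auto intro!: enn2real_mono krein_string_mono[OF M] ennreal_leI)

lemma stopped_mass_right_continuous: "continuous (at_right a) (stopped_mass M x)"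
proof -
  consider "a < 0" | "a \<ge> x" | "0 \<le> a" "a < x" by linarith
  then show ?thesis
  proof cases
    case 1
    then have "eventually (\<lambda>t. stopped_mass M x t = 0) (at_right a)"
      unfolding eventually_at_right[OF 1] stopped_mass_def by auto
    then have "(stopped_mass M x \<longlongrightarrow> 0) (at_right a)" by (rule tendsto_eventually)
    then show ?thesis using 1 by (simp add: continuous_within stopped_mass_def)
  next
    case 2
    then have "eventually (\<lambda>t. stopped_mass M x t = stopped_mass M x a) (at_right a)"
      using x by (auto simp: eventually_at_filter stopped_mass_def min_def intro!: always_eventually)
    then have "(stopped_mass M x \<longlongrightarrow> stopped_mass M x a) (at_right a)" by (rule tendsto_eventually)
    then show ?thesis by (simp add: continuous_within)
  next
    case 3
    have "(M \<longlongrightarrow> M (ennreal a)) (at_right (ennreal a))"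
      using M by (simp add: krein_string_def continuous_within)
    moreover have "filterlim ennreal (at_right (ennreal a)) (at_right a)"
      using 3 by (auto simp: filterlim_at eventually_at_filter ennreal_less_iff
          intro!: always_eventually tendsto_intros)
    ultimately have "((\<lambda>t. M (ennreal t)) \<longlongrightarrow> M (ennreal a)) (at_right a)"
      by (rule filterlim_compose)
    then have "((\<lambda>t. enn2real (M (ennreal t))) \<longlongrightarrow> enn2real (M (ennreal a))) (at_right a)"
      using mass_finite[of a] 3 by (intro tendsto_enn2real) auto
    moreover have "eventually (\<lambda>t. enn2real (M (ennreal t)) = stopped_mass M x t) (at_right a)"
      unfolding eventually_at_right[OF 3(2)] using 3 by (auto simp: stopped_mass_def min_def)
    ultimately have "(stopped_mass M x \<longlongrightarrow> enn2real (M (ennreal a))) (at_right a)"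
      by (rule Lim_transform_eventually)
    then show ?thesis using 3 by (simp add: continuous_within stopped_mass_def min_def)
  qed
qed

lemma finite_borel_string_measure: "finite_borel_measure (string_measure M x)"
  unfolding string_measure_altdef
proof (rule finite_borel_measure_interval_measure)
  have "eventually (\<lambda>t. stopped_mass M x t = 0) at_bot"
    unfolding eventually_at_bot_linorder by (rule exI[of _ "-1"]) (auto simp: stopped_mass_def)
  then show "(stopped_mass M x \<longlongrightarrow> 0) at_bot" by (rule tendsto_eventually)
  have "eventually (\<lambda>t. stopped_mass M x t = enn2real (M (ennreal x))) at_top"
    unfolding eventually_at_top_linorder using x
    by (intro exI[of _ x]) (auto simp: stopped_mass_def min_def)
  then show "(stopped_mass M x \<longlongrightarrow> enn2real (M (ennreal x))) at_top" by (rule tendsto_eventually)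
qed (auto intro: stopped_mass_mono stopped_mass_right_continuous)

text \<open>Finite Borel measures on the line are determined by their distribution functions. This is how
  the measures of related strings are compared throughout.\<close>

lemma cdf_string_measure: "cdf (string_measure M x) = stopped_mass M x"
proof
  fix t
  interpret finite_borel_measure "string_measure M x" by (rule finite_borel_string_measure)
  have diff: "cdf (string_measure M x) b - cdf (string_measure M x) a
      = stopped_mass M x b - stopped_mass M x a" if "a < b" for a b
    using cdf_diff_eq[OF that] that stopped_mass_mono stopped_mass_right_continuous
    unfolding string_measure_altdef by (subst (asm) measure_interval_measure_Ioc) auto
  have "cdf (string_measure M x) (- real n) = cdf (string_measure M x) (-1)" if "n \<ge> 1" for n
    using diff[of "- real n" "-1"] that by (cases "n = 1") (auto simp: stopped_mass_def)
  then have "eventually (\<lambda>n. cdf (string_measure M x) (- real n) = cdf (string_measure M x) (-1)) sequentially"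
    unfolding eventually_sequentially by blast
  then have "(\<lambda>n. cdf (string_measure M x) (- real n)) \<longlonglongrightarrow> cdf (string_measure M x) (-1)"
    by (rule tendsto_eventually)
  then have "cdf (string_measure M x) (-1) = 0"
    using cdf_lim_neg_infty LIMSEQ_unique by blast
  moreover have "stopped_mass M x (-1) = 0" by (simp add: stopped_mass_def)
  ultimately show "cdf (string_measure M x) t = stopped_mass M x t"
    using diff[of t "-1"] diff[of "-1" t] by (rule_tac linorder_cases[of t "-1"]) simp_all
qed

lemma measure_string_measure: "0 \<le> t \<Longrightarrow> measure (string_measure M x) {0..t} = enn2real (M (ennreal (min t x)))"
proof -
  assume "0 \<le> t"
  interpret finite_borel_measure "string_measure M x" by (rule finite_borel_string_measure)
  have "measure (string_measure M x) {..<0} = 0"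
  proof -
    have "eventually (\<lambda>t. stopped_mass M x t = 0) (at_left 0)"
      unfolding eventually_at_filter by (auto simp: stopped_mass_def)
    then have "(stopped_mass M x \<longlongrightarrow> 0) (at_left 0)" by (rule tendsto_eventually)
    then show ?thesis using cdf_at_left[of 0] unfolding cdf_string_measure
      using tendsto_unique trivial_limit_at_left_real by blast
  qed
  moreover have "measure (string_measure M x) {..t}
      = measure (string_measure M x) {..<0} + measure (string_measure M x) {0..t}"
    using \<open>0 \<le> t\<close> by (subst finite_measure_Union[symmetric]) (auto intro!: arg_cong[where f="measure _"])
  ultimately show ?thesis
    using fun_cong[OF cdf_string_measure, of t] \<open>0 \<le> t\<close> by (simp add: cdf_def stopped_mass_def)
qed

end

lemma sets_string_measure [simp, measurable_cong]: "sets (string_measure M x) = sets borel"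
  by (simp add: string_measure_altdef)

lemma space_string_measure [simp]: "space (string_measure M x) = UNIV"
  by (simp add: string_measure_altdef)

lemma finite_borel_measure_density_indicator:
  fixes \<mu> :: "real measure"
  assumes "finite_borel_measure \<mu>" "A \<in> sets borel"
  shows "finite_borel_measure (density \<mu> (indicator A))"
proof -
  interpret finite_borel_measure \<mu> by fact
  show ?thesis
    using finite_measure_restricted[of A] assms(2) M_is_borel
    by (simp add: finite_borel_measure_def finite_borel_measure_axioms_def)
qed

lemma cdf_density_indicator:
  fixes \<mu> :: "real measure"
  assumes "finite_borel_measure \<mu>" "A \<in> sets borel"
  shows "cdf (density \<mu> (indicator A)) t = measure \<mu> (A \<inter> {..t})"
proof -
  interpret finite_borel_measure \<mu> by fact
  show ?thesis unfolding cdf_def using assms(2) M_is_borel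
    by (subst measure_restricted) auto
qed

lemma set_integral_density_indicator:
  fixes f :: "real \<Rightarrow> real" and \<mu> :: "real measure"
  assumes "sets \<mu> = sets borel" "A \<in> sets borel" "B \<in> sets borel" "B \<subseteq> A"
  shows "set_integrable (density \<mu> (indicator A)) B f \<longleftrightarrow> set_integrable \<mu> B f"
    and "(LINT t:B|density \<mu> (indicator A). f t) = (LINT t:B|\<mu>. f t)"
proof -
  have A: "A \<in> sets \<mu>" and B: "B \<in> sets \<mu>" using assms by auto
  have AB: "A \<inter> B = B" using assms by auto
  have dens: "density \<mu> (indicator A) = density \<mu> (\<lambda>t. ennreal (indicator A t))"
    by (simp add: ennreal_indicator)
  have g: "indicator A t * (indicator B t * f t) = indicator B t * f t" for t
    using assms(4) by (auto simp: indicator_def)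
  have meas: "(\<lambda>t. indicator B t *\<^sub>R f t) \<in> borel_measurable \<mu>"
    if "set_integrable (density \<mu> (indicator A)) B f \<or> set_integrable \<mu> B f"
    using that unfolding set_integrable_def by (auto dest: borel_measurable_integrable)
  show iff: "set_integrable (density \<mu> (indicator A)) B f \<longleftrightarrow> set_integrable \<mu> B f"
  proof (cases "set_integrable (density \<mu> (indicator A)) B f \<or> set_integrable \<mu> B f")
    case True
    then show ?thesis unfolding set_integrable_def dens using A
      by (subst integrable_density[OF meas[OF True]]) (auto simp: g)
  qed simp
  show "(LINT t:B|density \<mu> (indicator A). f t) = (LINT t:B|\<mu>. f t)"
  proof (cases "set_integrable \<mu> B f")
    case True
    then show ?thesis unfolding set_lebesgue_integral_def dens using A meas
      by (subst integral_density) (auto simp: g)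
  next
    case False
    then show ?thesis using iff unfolding set_lebesgue_integral_def set_integrable_def
      by (simp add: not_integrable_integral_eq)
  qed
qed

lemma string_measure_restrict:
  assumes M: "krein_string M" and y: "0 \<le> y" "y \<le> x" and x: "ennreal x < string_length M"
  shows "string_measure M y = density (string_measure M x) (indicator {..y})"
proof (rule cdf_unique')
  have x0: "0 \<le> x" using y by simp
  have yL: "ennreal y < string_length M" using x y(2) by (meson ennreal_leI le_less_trans)
  note fin = finite_borel_string_measure[OF M x0 x]
  show "finite_borel_measure (string_measure M y)" by (rule finite_borel_string_measure[OF M y(1) yL])
  show "finite_borel_measure (density (string_measure M x) (indicator {..y}))"
    by (rule finite_borel_measure_density_indicator[OF fin]) simp
  show "cdf (string_measure M y) = cdf (density (string_measure M x) (indicator {..y}))"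
  proof
    fix t
    have "{..y} \<inter> {..t} = {..min y t}" by auto
    then have "cdf (density (string_measure M x) (indicator {..y})) t = cdf (string_measure M x) (min y t)"
      by (subst cdf_density_indicator[OF fin]) (simp_all add: cdf_def)
    then show "cdf (string_measure M y) t = cdf (density (string_measure M x) (indicator {..y})) t"
      using y unfolding cdf_string_measure[OF M x0 x] cdf_string_measure[OF M y(1) yL]
      by (auto simp: stopped_mass_def min_def)
  qed
qed

text \<open>The equation at \<open>y\<close> integrates against the mass stopped at \<open>y\<close>. For comparing values of a
  solution at different points all of them have to be integrals against one measure.\<close>

lemma string_integral_restrict:
  fixes f :: "real \<Rightarrow> real"
  assumes M: "krein_string M" and y: "0 \<le> y" "y \<le> x" and x: "ennreal x < string_length M"
  shows "set_integrable (string_measure M y) {0..y} f \<longleftrightarrow> set_integrable (string_measure M x) {0..y} f"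
    and "(LINT t:{0..y}|string_measure M y. f t) = (LINT t:{0..y}|string_measure M x. f t)"
  unfolding string_measure_restrict[OF assms]
  by (rule set_integral_density_indicator; simp add: subset_eq)+

section \<open>Gaps and masses at the origin\<close>

definition delay :: "real \<Rightarrow> (ennreal \<Rightarrow> ennreal) \<Rightarrow> ennreal \<Rightarrow> ennreal" where
  "delay c M x = (if x < ennreal c then 0 else M (x - ennreal c))"

definition add_mass :: "real \<Rightarrow> (ennreal \<Rightarrow> ennreal) \<Rightarrow> ennreal \<Rightarrow> ennreal" where
  "add_mass m M x = ennreal m + M x"

text \<open>Two extended lengths agree once the same finite numbers lie below them.\<close>

lemma string_length_eqI:
  assumes "krein_string M" "\<And>y. y < \<infinity> \<Longrightarrow> M y < \<infinity> \<longleftrightarrow> y < K"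
  shows "string_length M = K"
proof -
  have *: "y < string_length M \<longleftrightarrow> y < K" if "y < \<infinity>" for y
    using krein_string_finite_iff[OF assms(1) that] assms(2)[OF that] by simp
  show ?thesis
  proof (rule antisym; rule dense_le)
    fix y assume "y < string_length M"
    moreover from this have "y < \<infinity>"
      by (metis infinity_ennreal_def less_le_trans top_greatest)
    ultimately show "y \<le> K" using *[of y] by (metis less_imp_le)
  next
    fix y assume "y < K"
    moreover from this have "y < \<infinity>"
      by (metis infinity_ennreal_def less_le_trans top_greatest)
    ultimately show "y \<le> string_length M" using *[of y] by (metis less_imp_le)
  qed
qed

lemma ennreal_diff_less_iff:
  fixes x y :: ennreal
  assumes "ennreal c \<le> x"
  shows "x - ennreal c < y \<longleftrightarrow> x < ennreal c + y"
  using assms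
  by (cases x; cases y; cases "c \<ge> 0")
     (auto simp: ennreal_minus ennreal_less_iff ennreal_neg simp flip: ennreal_plus)

lemma krein_string_delay:
  assumes "krein_string M"
  shows "krein_string (delay c M)"
proof -
  have mono: "mono (delay c M)"
  proof
    fix x y :: ennreal assume "x \<le> y"
    then show "delay c M x \<le> delay c M y"
      using krein_string_mono[OF assms, of "x - ennreal c" "y - ennreal c"]
      by (auto simp: delay_def ennreal_minus_mono)
  qed
  have "\<exists>z>x. delay c M z < y" if "x < \<infinity>" "y > delay c M x" for x y
  proof (cases "x < ennreal c")
    case True
    then show ?thesis using that dense[OF True] by (auto simp: delay_def)
  next
    case False
    then have "x - ennreal c < \<infinity>" "M (x - ennreal c) < y"
      using that by (auto simp: delay_def ennreal_diff_less_iff)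
    then obtain z where z: "z > x - ennreal c" "M z < y"
      using assms unfolding krein_string_iff by blast
    have "x < ennreal c + z" using z(1) False by (subst (asm) ennreal_diff_less_iff) auto
    moreover have "delay c M (ennreal c + z) < y"
      using z(2) False by (auto simp: delay_def)
    ultimately show ?thesis by blast
  qed
  then show ?thesis
    using mono assms unfolding krein_string_iff by (simp add: delay_def)
qed

lemma string_length_delay:
  assumes "krein_string M"
  shows "string_length (delay c M) = ennreal c + string_length M"
proof (rule string_length_eqI[OF krein_string_delay[OF assms]])
  fix y :: ennreal assume "y < \<infinity>"
  show "delay c M y < \<infinity> \<longleftrightarrow> y < ennreal c + string_length M"
  proof (cases "y < ennreal c")
    case True
    then show ?thesis using less_le_trans[OF True, of "ennreal c + string_length M"]
      by (simp add: delay_def)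
  next
    case False
    have "y - ennreal c < \<infinity>"
      using \<open>y < \<infinity>\<close> False by (subst ennreal_diff_less_iff) auto
    with False show ?thesis
      using krein_string_finite_iff[OF assms] by (simp add: delay_def ennreal_diff_less_iff)
  qed
qed

lemma krein_string_add_mass:
  assumes "krein_string M"
  shows "krein_string (add_mass m M)"
proof -
  have "\<exists>z>x. add_mass m M z < y" if x: "x < \<infinity>" "y > add_mass m M x" for x y
  proof -
    have "ennreal m \<le> y" using x(2) by (metis add_mass_def le_iff_add less_imp_le order_trans)
    have "M x < y - ennreal m"
      using x(2) \<open>ennreal m \<le> y\<close> unfolding add_mass_def
      by (cases "M x"; cases y; cases "m \<ge> 0")
        (auto simp: ennreal_minus ennreal_less_iff ennreal_neg simp flip: ennreal_plus)
    then obtain z where z: "z > x" "M z < y - ennreal m"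
      using assms x unfolding krein_string_iff by blast
    then have "add_mass m M z < y"
      using \<open>ennreal m \<le> y\<close> unfolding add_mass_def
      by (cases "M z"; cases y; cases "m \<ge> 0")
        (auto simp: ennreal_minus ennreal_less_iff ennreal_neg simp flip: ennreal_plus)
    with z show ?thesis by blast
  qed
  then show ?thesis
    using assms unfolding krein_string_iff by (auto simp: add_mass_def mono_def)
qed

lemma string_length_add_mass:
  assumes "krein_string M"
  shows "string_length (add_mass m M) = string_length M"
  by (rule string_length_eqI[OF krein_string_add_mass[OF assms]])
     (simp add: krein_string_finite_iff[OF assms, symmetric] add_mass_def)

lemma string_measure_delay:
  assumes M: "krein_string M" and c: "c \<ge> 0" and x: "0 \<le> x" "ennreal x < string_length M"
  shows "string_measure (delay c M) (x + c) = distr (string_measure M x) borel (\<lambda>t. t + c)"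
proof (rule cdf_unique')
  note M' = krein_string_delay[OF M, of c]
  have x': "0 \<le> x + c" "ennreal (x + c) < string_length (delay c M)"
    using x c unfolding string_length_delay[OF M]
    by (cases "string_length M"; auto simp: ennreal_less_iff simp flip: ennreal_plus)+
  interpret finite_borel_measure "string_measure M x" by (rule finite_borel_string_measure[OF M x])
  show "finite_borel_measure (string_measure (delay c M) (x + c))"
    by (rule finite_borel_string_measure[OF M' x'])
  show "finite_borel_measure (distr (string_measure M x) borel (\<lambda>t. t + c))"
    unfolding finite_borel_measure_def finite_borel_measure_axioms_def
    by (auto intro!: finite_measure_distr)
  show "cdf (string_measure (delay c M) (x + c)) = cdf (distr (string_measure M x) borel (\<lambda>t. t + c))"
  proof
    fix t
    have "cdf (distr (string_measure M x) borel (\<lambda>t. t + c)) t = cdf (string_measure M x) (t - c)"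
      unfolding cdf_def by (subst measure_distr) (auto intro!: arg_cong[where f="measure _"])
    also have "\<dots> = stopped_mass (delay c M) (x + c) t"
      using x c unfolding cdf_string_measure[OF M x] stopped_mass_def delay_def
      by (auto simp: ennreal_minus ennreal_less_iff min_def field_simps)
    finally show "cdf (string_measure (delay c M) (x + c)) t
      = cdf (distr (string_measure M x) borel (\<lambda>t. t + c)) t"
      unfolding cdf_string_measure[OF M' x'] by simp
  qed
qed

text \<open>Since a translation is invertible, the substitution rule holds for every function, measurable
  or not. This matters because a solution is only known to be measurable where the equation says so.\<close>

lemma integral_distr_shift:
  fixes f :: "real \<Rightarrow> real" and \<mu> :: "real measure"
  assumes [measurable_cong, simp]: "sets \<mu> = sets borel"
  shows "integrable (distr \<mu> borel (\<lambda>t. t + c)) f \<longleftrightarrow> integrable \<mu> (\<lambda>t. f (t + c))"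
    and "integral\<^sup>L (distr \<mu> borel (\<lambda>t. t + c)) f = integral\<^sup>L \<mu> (\<lambda>t. f (t + c))"
proof -
  have undo: "distr (distr \<mu> borel (\<lambda>t. t + c)) borel (\<lambda>t. t - c) = \<mu>"
    by (subst distr_distr) (auto simp: o_def intro!: distr_id2)
  show iff: "integrable (distr \<mu> borel (\<lambda>t. t + c)) f \<longleftrightarrow> integrable \<mu> (\<lambda>t. f (t + c))"
    using integrable_distr[of "\<lambda>t. t + c" \<mu> borel f]
      integrable_distr[of "\<lambda>t. t - c" "distr \<mu> borel (\<lambda>t. t + c)" borel "\<lambda>t. f (t + c)"]
    unfolding undo by auto
  show "integral\<^sup>L (distr \<mu> borel (\<lambda>t. t + c)) f = integral\<^sup>L \<mu> (\<lambda>t. f (t + c))"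
  proof (cases "integrable (distr \<mu> borel (\<lambda>t. t + c)) f")
    case True
    then have "f \<in> borel_measurable borel" using borel_measurable_integrable[OF True] by simp
    then show ?thesis by (intro integral_distr) auto
  next
    case False
    then show ?thesis using iff by (simp add: not_integrable_integral_eq)
  qed
qed

lemma string_integral_delay:
  fixes f :: "real \<Rightarrow> real"
  assumes M: "krein_string M" and c: "c \<ge> 0" and x: "0 \<le> x" "ennreal x < string_length M"
  shows "set_integrable (string_measure (delay c M) (x + c)) {c..x+c} f
          \<longleftrightarrow> set_integrable (string_measure M x) {0..x} (\<lambda>t. f (t + c))"
    and "(LINT t:{c..x+c}|string_measure (delay c M) (x + c). f t)
          = (LINT t:{0..x}|string_measure M x. f (t + c))"
proof -
  have ind: "indicator {c..x+c} (t + c) *\<^sub>R f (t + c) = indicator {0..x} t *\<^sub>R f (t + c)" for t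
    by (auto simp: indicator_def)
  show "set_integrable (string_measure (delay c M) (x + c)) {c..x+c} f
          \<longleftrightarrow> set_integrable (string_measure M x) {0..x} (\<lambda>t. f (t + c))"
    unfolding set_integrable_def string_measure_delay[OF assms]
    by (subst integral_distr_shift) (simp_all only: ind sets_string_measure)
  show "(LINT t:{c..x+c}|string_measure (delay c M) (x + c). f t)
          = (LINT t:{0..x}|string_measure M x. f (t + c))"
    unfolding set_lebesgue_integral_def string_measure_delay[OF assms]
    by (subst integral_distr_shift) (simp_all only: ind sets_string_measure)
qed

lemma set_integral_measure_0:
  fixes f :: "real \<Rightarrow> real"
  assumes "finite_borel_measure \<nu>" "A \<in> sets borel" "measure \<nu> A = 0"
  shows "f \<in> borel_measurable borel \<Longrightarrow> set_integrable \<nu> A f"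
    and "(LINT t:A|\<nu>. f t) = 0"
proof -
  interpret finite_borel_measure \<nu> by fact
  note [measurable_cong] = M_is_borel
  have [measurable]: "A \<in> sets \<nu>" using assms(2) by auto
  have "AE t in \<nu>. t \<notin> A"
    using assms(3) by (intro AE_not_in) (simp add: null_sets_def emeasure_eq_measure)
  then have AE0: "AE t in \<nu>. indicator A t *\<^sub>R f t = 0" by eventually_elim auto
  show "set_integrable \<nu> A f" if [measurable]: "f \<in> borel_measurable borel"
    unfolding set_integrable_def using AE0
    by (subst integrable_cong_AE[of _ _ "\<lambda>_. 0"]) auto
  show "(LINT t:A|\<nu>. f t) = 0"
    unfolding set_lebesgue_integral_def by (rule integral_eq_zero_AE[OF AE0])
qed

lemma measure_string_measure_massless:
  assumes M: "krein_string M" and x: "0 \<le> x" "ennreal x < string_length M"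
    and c: "c \<le> x" and z: "\<And>t. 0 \<le> t \<Longrightarrow> t < c \<Longrightarrow> M (ennreal t) = 0"
  shows "measure (string_measure M x) {0..<c} = 0"
proof -
  interpret finite_borel_measure "string_measure M x" by (rule finite_borel_string_measure[OF M x])
  have "cdf (string_measure M x) t = 0" if "t < c" for t
    using that z[of t] c unfolding cdf_string_measure[OF M x] stopped_mass_def by (auto simp: min_def)
  then have "eventually (\<lambda>t. cdf (string_measure M x) t = 0) (at_left c)"
    by (auto simp: eventually_at_filter)
  then have "(cdf (string_measure M x) \<longlongrightarrow> 0) (at_left c)" by (rule tendsto_eventually)
  then have "measure (string_measure M x) {..<c} = 0"
    using cdf_at_left[of c] tendsto_unique trivial_limit_at_left_real by blast
  then show ?thesis
    using finite_measure_mono[of "{0..<c}" "{..<c}"] by (simp add: antisym subset_eq)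
qed

text \<open>Integrability over the atom at the origin is automatic for any function, so an extra mass
  there can be detached from the rest of the measure.\<close>

lemma string_integral_split_origin:
  fixes f :: "real \<Rightarrow> real"
  assumes M: "krein_string M" and x: "0 \<le> x" "ennreal x < string_length M"
  shows "set_integrable (string_measure M x) {0..x} f \<longleftrightarrow> set_integrable (string_measure M x) {0<..x} f"
    and "set_integrable (string_measure M x) {0<..x} f \<Longrightarrow> (LINT t:{0..x}|string_measure M x. f t)
         = enn2real (M 0) * f 0 + (LINT t:{0<..x}|string_measure M x. f t)"
proof -
  interpret finite_borel_measure "string_measure M x" by (rule finite_borel_string_measure[OF M x])
  have split: "{0..x} = {0} \<union> {0<..x}" using x by auto
  have ind: "indicator {0} t *\<^sub>R f t = indicator {0} t * f 0" for t :: real by (auto simp: indicator_def)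
  have 0: "set_integrable (string_measure M x) {0} f"
    unfolding set_integrable_def ind
    by (intro integrable_mult_left integrable_real_indicator) (auto simp: emeasure_eq_measure)
  show "set_integrable (string_measure M x) {0..x} f \<longleftrightarrow> set_integrable (string_measure M x) {0<..x} f"
    unfolding split
    using set_integrable_Un[OF 0, of "{0<..x}"]
      set_integrable_subset[of "string_measure M x" "{0} \<union> {0<..x}" f "{0<..x}"]
    by auto
  assume *: "set_integrable (string_measure M x) {0<..x} f"
  have "measure (string_measure M x) {0} = enn2real (M 0)"
    using measure_string_measure[OF M x, of 0] x by (simp add: min_def)
  then have "(LINT t:{0}|string_measure M x. f t) = enn2real (M 0) * f 0"
    unfolding set_lebesgue_integral_def ind by simp
  then show "(LINT t:{0..x}|string_measure M x. f t)
         = enn2real (M 0) * f 0 + (LINT t:{0<..x}|string_measure M x. f t)"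
    unfolding split by (subst set_integral_Un[OF _ 0 *]) auto
qed

lemma string_measure_add_mass:
  assumes M: "krein_string M" and m: "m \<ge> 0" and x: "0 \<le> x" "ennreal x < string_length M"
  shows "density (string_measure (add_mass m M) x) (indicator {0<..})
    = density (string_measure M x) (indicator {0<..})"
proof (rule cdf_unique')
  note M' = krein_string_add_mass[OF M, of m]
  have x': "ennreal x < string_length (add_mass m M)"
    using x by (simp add: string_length_add_mass[OF M])
  note fin = finite_borel_string_measure[OF M x] finite_borel_string_measure[OF M' x(1) x']
  show "finite_borel_measure (density (string_measure (add_mass m M) x) (indicator {0<..}))"
    "finite_borel_measure (density (string_measure M x) (indicator {0<..}))"
    using fin by (auto intro!: finite_borel_measure_density_indicator)
  have *: "measure (string_measure N x) ({0<..} \<inter> {..t})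
      = (if t \<le> 0 then 0 else stopped_mass N x t - stopped_mass N x 0)"
    if "krein_string N" "ennreal x < string_length N" for N t
  proof (cases "t \<le> 0")
    case True
    then have "{0<..} \<inter> {..t} = {}" by auto
    then show ?thesis using True by simp
  next
    case False
    then have "{0<..} \<inter> {..t} = {0<..t}" by auto
    then show ?thesis
      using False finite_borel_measure.cdf_diff_eq[OF finite_borel_string_measure[OF that(1) x(1) that(2)], of 0 t]
      by (simp add: cdf_string_measure[OF that(1) x(1) that(2)])
  qed
  show "cdf (density (string_measure (add_mass m M) x) (indicator {0<..}))
      = cdf (density (string_measure M x) (indicator {0<..}))"
  proof
    fix t
    have "stopped_mass (add_mass m M) x t - stopped_mass (add_mass m M) x 0
      = stopped_mass M x t - stopped_mass M x 0" if "t > 0"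
      using mass_finite[OF M x, of "min t x"] mass_finite[OF M x, of 0] that x m
      by (auto simp: stopped_mass_def add_mass_def enn2real_plus)
    then show "cdf (density (string_measure (add_mass m M) x) (indicator {0<..})) t
      = cdf (density (string_measure M x) (indicator {0<..})) t"
      using *[OF M x(2)] *[OF M' x'] by (simp add: cdf_density_indicator[OF fin(1)] cdf_density_indicator[OF fin(2)])
  qed
qed

lemma string_integral_add_mass:
  fixes f :: "real \<Rightarrow> real"
  assumes M: "krein_string M" and m: "m \<ge> 0" and x: "0 \<le> x" "ennreal x < string_length M"
  shows "set_integrable (string_measure (add_mass m M) x) {0..x} f
          \<longleftrightarrow> set_integrable (string_measure M x) {0..x} f"
    and "set_integrable (string_measure M x) {0..x} f \<Longrightarrow>
          (LINT t:{0..x}|string_measure (add_mass m M) x. f t)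
          = m * f 0 + (LINT t:{0..x}|string_measure M x. f t)"
proof -
  note M' = krein_string_add_mass[OF M, of m]
  have x': "ennreal x < string_length (add_mass m M)"
    using x by (simp add: string_length_add_mass[OF M])
  have pos: "set_integrable (string_measure (add_mass m M) x) {0<..x} f
          \<longleftrightarrow> set_integrable (string_measure M x) {0<..x} f"
    "(LINT t:{0<..x}|string_measure (add_mass m M) x. f t) = (LINT t:{0<..x}|string_measure M x. f t)"
    using set_integral_density_indicator[of "string_measure (add_mass m M) x" "{0<..}" "{0<..x}" f]
      set_integral_density_indicator[of "string_measure M x" "{0<..}" "{0<..x}" f]
    by (simp_all add: string_measure_add_mass[OF assms] subset_eq)
  show iff: "set_integrable (string_measure (add_mass m M) x) {0..x} f
          \<longleftrightarrow> set_integrable (string_measure M x) {0..x} f"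
    using pos string_integral_split_origin(1)[OF M x] string_integral_split_origin(1)[OF M' x(1) x'] by simp
  assume "set_integrable (string_measure M x) {0..x} f"
  moreover have "enn2real (add_mass m M 0) = m + enn2real (M 0)"
    using mass_finite[OF M x, of 0] x m by (simp add: add_mass_def enn2real_plus)
  ultimately show "(LINT t:{0..x}|string_measure (add_mass m M) x. f t)
          = m * f 0 + (LINT t:{0..x}|string_measure M x. f t)"
    using pos iff string_integral_split_origin[OF M x] string_integral_split_origin[OF M' x(1) x']
    by (simp add: algebra_simps)
qed

section \<open>Solutions of the string equation\<close>

text \<open>For \<open>x = 0\<close> only the atom at the origin is integrated, and its weight is \<open>x - t = 0\<close>.\<close>

lemma string_solution_at_0:
  assumes "string_solution M z a b u" "string_length M > 0"
  shows "u 0 = a"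
proof -
  have "u 0 = a + b * 0 - z * (LINT t:{0..0}|string_measure M 0. (0 - t) * u t)"
    using assms unfolding string_solution_def by fastforce
  moreover have "(LINT t:{0..0}|string_measure M 0. (0 - t) * u t) = 0"
  proof -
    have eq: "(\<lambda>t::real. indicator {0..0} t *\<^sub>R ((0 - t) * u t)) = (\<lambda>_. 0)"
      by (auto simp: indicator_def)
    show ?thesis unfolding set_lebesgue_integral_def eq by simp
  qed
  ultimately show ?thesis by (simp only: mult_zero_right add_0_right diff_0_right)
qed

lemma string_solution_lincomb:
  assumes "string_solution M z a b u" "string_solution M z a' b' v"
  shows "string_solution M z (p * a + q * a') (p * b + q * b') (\<lambda>x. p * u x + q * v x)"
  unfolding string_solution_def
proof (intro allI impI)
  fix x :: real assume x: "0 \<le> x" "ennreal x < string_length M"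
  note u = assms(1)[unfolded string_solution_def, rule_format, OF x]
  note v = assms(2)[unfolded string_solution_def, rule_format, OF x]
  have eq: "(\<lambda>t. (x - t) * (p * u t + q * v t)) = (\<lambda>t. p * ((x - t) * u t) + q * ((x - t) * v t))"
    by (auto simp: algebra_simps)
  have iu: "set_integrable (string_measure M x) {0..x} (\<lambda>t. p * ((x - t) * u t))"
    and iv: "set_integrable (string_measure M x) {0..x} (\<lambda>t. q * ((x - t) * v t))"
    using u v by auto
  define I J where "I = (LINT t:{0..x}|string_measure M x. (x - t) * u t)"
    and "J = (LINT t:{0..x}|string_measure M x. (x - t) * v t)"
  have "(LINT t:{0..x}|string_measure M x. (x - t) * (p * u t + q * v t)) = p * I + q * J"
    unfolding eq I_def J_def using set_integral_add(2)[OF iu iv] by simp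
  moreover have "set_integrable (string_measure M x) {0..x} (\<lambda>t. (x - t) * (p * u t + q * v t))"
    unfolding eq using set_integral_add(1)[OF iu iv] .
  moreover have "u x = a + b * x - z * I" "v x = a' + b' * x - z * J"
    using u v by (auto simp: I_def J_def)
  ultimately show "set_integrable (string_measure M x) {0..x} (\<lambda>t. (x - t) * (p * u t + q * v t))
     \<and> p * u x + q * v x = p * a + q * a' + (p * b + q * b') * x
        - z * (LINT t:{0..x}|string_measure M x. (x - t) * (p * u t + q * v t))"
    by (simp only:) (simp add: algebra_simps)
qed

text \<open>The extra term \<open>-z m (x - 0) u(0)\<close> is linear in \<open>x\<close> because \<open>u(0) = a\<close>: a mass at the origin
  only changes the initial slope.\<close>

lemma string_solution_add_mass:
  assumes M: "krein_string M" and m: "m \<ge> 0"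
  shows "string_solution (add_mass m M) z a b u \<longleftrightarrow> string_solution M z a (b - z * m * a) u"
proof -
  have *: "(set_integrable (string_measure (add_mass m M) x) {0..x} (\<lambda>t. (x - t) * u t) \<and>
        u x = a + b * x - z * (LINT t:{0..x}|string_measure (add_mass m M) x. (x - t) * u t))
     \<longleftrightarrow> (set_integrable (string_measure M x) {0..x} (\<lambda>t. (x - t) * u t) \<and>
        u x = a + (b - z * m * a) * x - z * (LINT t:{0..x}|string_measure M x. (x - t) * u t))"
    if x: "0 \<le> x" "ennreal x < string_length M" and u0: "u 0 = a" for x
    using string_integral_add_mass(1)[OF M m x, of "\<lambda>t. (x - t) * u t"]
      string_integral_add_mass(2)[OF M m x, of "\<lambda>t. (x - t) * u t"] u0
    by (auto simp: algebra_simps)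
  show ?thesis
  proof (cases "string_length M > 0")
    case False
    then show ?thesis unfolding string_solution_def string_length_add_mass[OF M] by simp
  next
    case True
    show ?thesis
    proof
      assume s: "string_solution (add_mass m M) z a b u"
      then have "u 0 = a" using string_solution_at_0 True string_length_add_mass[OF M] by simp
      then show "string_solution M z a (b - z * m * a) u"
        using s * unfolding string_solution_def string_length_add_mass[OF M] by blast
    next
      assume s: "string_solution M z a (b - z * m * a) u"
      then have "u 0 = a" using string_solution_at_0 True by simp
      then show "string_solution (add_mass m M) z a b u"
        using s * unfolding string_solution_def string_length_add_mass[OF M] by blast
    qed
  qed
qed

lemma add_less_ennreal_iff:
  assumes "0 \<le> y" "0 \<le> c"
  shows "ennreal (y + c) < ennreal c + K \<longleftrightarrow> ennreal y < K"
  using assms by (cases K) (auto simp: ennreal_less_iff simp flip: ennreal_plus)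

lemma string_integral_no_mass:
  fixes f :: "real \<Rightarrow> real"
  assumes M: "krein_string M" and x: "0 \<le> x" "ennreal x < string_length M" and z: "M (ennreal x) = 0"
  shows "f \<in> borel_measurable borel \<Longrightarrow> set_integrable (string_measure M x) {0..x} f"
    and "(LINT t:{0..x}|string_measure M x. f t) = 0"
proof -
  have "measure (string_measure M x) {0..x} = 0"
    using measure_string_measure[OF M x x(1)] z by simp
  note null = set_integral_measure_0[OF finite_borel_string_measure[OF M x] _ this]
  show "f \<in> borel_measurable borel \<Longrightarrow> set_integrable (string_measure M x) {0..x} f"
    by (rule null(1)) auto
  show "(LINT t:{0..x}|string_measure M x. f t) = 0" by (rule null(2)) auto
qed

text \<open>On the gap the integrand is required to agree with a Borel function because a null set alone
  does not make it integrable.\<close>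

lemma string_integral_delay_full:
  fixes f :: "real \<Rightarrow> real"
  assumes M: "krein_string M" and c: "c \<ge> 0" and y: "0 \<le> y" "ennreal y < string_length M"
    and f: "\<And>t. 0 \<le> t \<Longrightarrow> t < c \<Longrightarrow> f t = g t" "g \<in> borel_measurable borel"
  shows "set_integrable (string_measure (delay c M) (y + c)) {0..y+c} f
          \<longleftrightarrow> set_integrable (string_measure M y) {0..y} (\<lambda>t. f (t + c))"
    and "set_integrable (string_measure M y) {0..y} (\<lambda>t. f (t + c)) \<Longrightarrow>
          (LINT t:{0..y+c}|string_measure (delay c M) (y + c). f t)
          = (LINT t:{0..y}|string_measure M y. f (t + c))"
proof -
  note M' = krein_string_delay[OF M, of c]
  have yc: "0 \<le> y + c" "ennreal (y + c) < string_length (delay c M)"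
    using y c by (simp_all add: string_length_delay[OF M] add_less_ennreal_iff)
  have zero: "delay c M (ennreal t) = 0" if "0 \<le> t" "t < c" for t
    using that by (simp add: delay_def ennreal_less_iff)
  have "measure (string_measure (delay c M) (y + c)) {0..<c} = 0"
    using y by (intro measure_string_measure_massless[OF M' yc _ zero]) auto
  note null = set_integral_measure_0[OF finite_borel_string_measure[OF M' yc] _ this]
  have int: "set_integrable (string_measure (delay c M) (y + c)) {0..<c} f"
  proof -
    have "set_integrable (string_measure (delay c M) (y + c)) {0..<c} f
      \<longleftrightarrow> set_integrable (string_measure (delay c M) (y + c)) {0..<c} g"
      using f(1) by (intro set_integrable_cong) auto
    then show ?thesis using null(1)[OF _ f(2)] by auto
  qed
  have split: "{0..y+c} = {0..<c} \<union> {c..y+c}" using y c by auto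
  show iff: "set_integrable (string_measure (delay c M) (y + c)) {0..y+c} f
          \<longleftrightarrow> set_integrable (string_measure M y) {0..y} (\<lambda>t. f (t + c))"
    unfolding string_integral_delay(1)[OF M c y, symmetric] unfolding split
    using set_integrable_Un[OF int, of "{c..y+c}"]
      set_integrable_subset[of "string_measure (delay c M) (y + c)" "{0..<c} \<union> {c..y+c}" f "{c..y+c}"]
    by auto
  assume "set_integrable (string_measure M y) {0..y} (\<lambda>t. f (t + c))"
  then have "set_integrable (string_measure (delay c M) (y + c)) {c..y+c} f"
    unfolding string_integral_delay(1)[OF M c y] .
  then show "(LINT t:{0..y+c}|string_measure (delay c M) (y + c). f t)
          = (LINT t:{0..y}|string_measure M y. f (t + c))"
    unfolding string_integral_delay(2)[OF M c y, symmetric] split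
    using set_integral_Un[OF _ int, of "{c..y+c}"] null(2)[of f]
    by (simp add: ivl_disj_int)
qed

text \<open>Along the gap the solution is a straight line, and its value and slope at the end of the gap are
  the initial values for the remaining string. The equivalence allows a gap to be removed as well as
  inserted.\<close>

lemma string_solution_delay:
  assumes M: "krein_string M" and c: "c \<ge> 0"
  shows "string_solution (delay c M) z a b u \<longleftrightarrow>
    (\<forall>x. 0 \<le> x \<longrightarrow> x < c \<longrightarrow> u x = a + b * x) \<and> string_solution M z (a + b * c) b (\<lambda>x. u (x + c))"
proof -
  note M' = krein_string_delay[OF M, of c]
  let ?I = "\<lambda>x. set_integrable (string_measure (delay c M) x) {0..x} (\<lambda>t. (x - t) * u t)"
  let ?E = "\<lambda>x. u x = a + b * x - z * (LINT t:{0..x}|string_measure (delay c M) x. (x - t) * u t)"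
  let ?J = "\<lambda>y. set_integrable (string_measure M y) {0..y} (\<lambda>t. (y - t) * u (t + c))"
  let ?F = "\<lambda>y. u (y + c) = a + b * c + b * y - z * (LINT t:{0..y}|string_measure M y. (y - t) * u (t + c))"
  have len: "string_length (delay c M) = ennreal c + string_length M"
    by (rule string_length_delay[OF M])
  have early: "(LINT t:{0..x}|string_measure (delay c M) x. (x - t) * u t) = 0"
      "u \<in> borel_measurable borel \<Longrightarrow>
        set_integrable (string_measure (delay c M) x) {0..x} (\<lambda>t. (x - t) * u t)"
      "ennreal x < string_length (delay c M)"
    if x: "0 \<le> x" "x < c" for x u
  proof -
    show xL: "ennreal x < string_length (delay c M)"
      using x by (simp add: len ennreal_less_iff less_le_trans[of "ennreal x" "ennreal c"])
    have "delay c M (ennreal x) = 0" using x by (simp add: delay_def ennreal_less_iff)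
    note null = string_integral_no_mass[OF M' x(1) xL this]
    show "(LINT t:{0..x}|string_measure (delay c M) x. (x - t) * u t) = 0" by (rule null(2))
    show "set_integrable (string_measure (delay c M) x) {0..x} (\<lambda>t. (x - t) * u t)"
      if [measurable]: "u \<in> borel_measurable borel"
      by (rule null(1)) measurable
  qed
  have late: "?I (y + c) \<and> ?E (y + c) \<longleftrightarrow> ?J y \<and> ?F y"
    if y: "0 \<le> y" "ennreal y < string_length M" and lin: "\<forall>x. 0 \<le> x \<longrightarrow> x < c \<longrightarrow> u x = a + b * x" for y
  proof -
    have "?I (y + c) \<longleftrightarrow> ?J y"
      using lin
      by (subst string_integral_delay_full(1)[OF M c y, where g="\<lambda>t. (y + c - t) * (a + b * t)"]) auto
    moreover have "?J y \<Longrightarrow> (LINT t:{0..y+c}|string_measure (delay c M) (y + c). (y + c - t) * u t)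
        = (LINT t:{0..y}|string_measure M y. (y - t) * u (t + c))"
      using lin
      by (subst string_integral_delay_full(2)[OF M c y, where g="\<lambda>t. (y + c - t) * (a + b * t)"]) auto
    ultimately show ?thesis by (auto simp: algebra_simps)
  qed
  show ?thesis
  proof
    assume s: "string_solution (delay c M) z a b u"
    then have lin: "\<forall>x. 0 \<le> x \<longrightarrow> x < c \<longrightarrow> u x = a + b * x"
      using early(1,3) unfolding string_solution_def by auto
    moreover have "?J y \<and> ?F y" if y: "0 \<le> y" "ennreal y < string_length M" for y
    proof -
      have "?I (y + c) \<and> ?E (y + c)"
        using s y c unfolding string_solution_def by (simp add: len add_less_ennreal_iff)
      then show ?thesis using late[OF y lin] by blast
    qed
    ultimately show "(\<forall>x. 0 \<le> x \<longrightarrow> x < c \<longrightarrow> u x = a + b * x)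
        \<and> string_solution M z (a + b * c) b (\<lambda>x. u (x + c))"
      unfolding string_solution_def by blast
  next
    assume s: "(\<forall>x. 0 \<le> x \<longrightarrow> x < c \<longrightarrow> u x = a + b * x)
        \<and> string_solution M z (a + b * c) b (\<lambda>x. u (x + c))"
    show "string_solution (delay c M) z a b u"
      unfolding string_solution_def
    proof (intro allI impI)
      fix x :: real assume x: "0 \<le> x" "ennreal x < string_length (delay c M)"
      show "?I x \<and> ?E x"
      proof (cases "x < c")
        case True
        have "?I x \<longleftrightarrow> set_integrable (string_measure (delay c M) x) {0..x} (\<lambda>t. (x - t) * (a + b * t))"
          using s True by (intro set_integrable_cong) auto
        then have "?I x" using early(2)[OF x(1) True, of "\<lambda>t. a + b * t"] by simp
        then show ?thesis using s True x early(1)[OF x(1) True] by simp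
      next
        case False
        then have "0 \<le> x - c" "ennreal (x - c) < string_length M"
          using x(2) add_less_ennreal_iff[of "x - c" c "string_length M"] c unfolding len by auto
        then have "?I (x - c + c) \<and> ?E (x - c + c)"
          using late[of "x - c"] s unfolding string_solution_def by blast
        then show ?thesis by (simp only: diff_add_cancel)
      qed
    qed
  qed
qed

lemma string_solution_integral:
  assumes M: "krein_string M" and s: "string_solution M z a b u"
    and x: "0 \<le> x" "x \<le> X" "ennreal X < string_length M"
  shows "set_integrable (string_measure M X) {0..x} (\<lambda>t. (x - t) * u t)"
    and "u x = a + b * x - z * (LINT t:{0..x}|string_measure M X. (x - t) * u t)"
proof -
  have "ennreal x < string_length M" using x by (meson ennreal_leI le_less_trans)
  with s x(1) have "set_integrable (string_measure M x) {0..x} (\<lambda>t. (x - t) * u t) \<and>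
    u x = a + b * x - z * (LINT t:{0..x}|string_measure M x. (x - t) * u t)"
    unfolding string_solution_def by blast
  then show "set_integrable (string_measure M X) {0..x} (\<lambda>t. (x - t) * u t)"
    "u x = a + b * x - z * (LINT t:{0..x}|string_measure M X. (x - t) * u t)"
    unfolding string_integral_restrict[OF M x] by blast+
qed

text \<open>A solution is integrable below any point where the equation holds: integrability of
  \<open>(Y - t) u(t)\<close> gives that of \<open>u(t)\<close> for \<open>t \<le> X < Y\<close>. Hence the integral of \<open>(x - t)\<^sup>+ u(t)\<close> is
  Lipschitz in \<open>x\<close>.\<close>

lemma string_solution_continuous:
  assumes M: "krein_string M" and s: "string_solution M z a b u"
    and X: "0 \<le> X" "ennreal X < string_length M"
  shows "continuous_on {0..X} u"
proof -
  obtain Y where Y: "X < Y" "ennreal Y < string_length M"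
  proof -
    obtain y where "ennreal X < y" "y < string_length M" using dense[OF X(2)] by blast
    then show ?thesis using that X
      by (cases y) (auto simp: ennreal_less_iff)
  qed
  let ?\<nu> = "string_measure M Y"
  have "set_integrable ?\<nu> {0..Y} (\<lambda>t. (Y - t) * u t)"
    using string_solution_integral(1)[OF M s _ _ Y(2)] X Y by simp
  then have "set_integrable ?\<nu> {0..X} (\<lambda>t. (Y - t) * u t)"
    using Y by (elim set_integrable_subset) auto
  then have int: "integrable ?\<nu> (\<lambda>t. indicator {0..X} t *\<^sub>R ((Y - t) * u t))"
    unfolding set_integrable_def .
  then have [measurable]: "(\<lambda>t. indicator {0..X} t *\<^sub>R ((Y - t) * u t)) \<in> borel_measurable ?\<nu>"
    by (rule borel_measurable_integrable)
  have "integrable ?\<nu> (\<lambda>t. (1 / max (Y - X) (Y - t)) * (indicator {0..X} t *\<^sub>R ((Y - t) * u t)))"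
  proof (rule Bochner_Integration.integrable_bound)
    show "integrable ?\<nu> (\<lambda>t. 1 / (Y - X) * (indicator {0..X} t *\<^sub>R ((Y - t) * u t)))"
      using int by (rule integrable_mult_right)
    show "(\<lambda>t. (1 / max (Y - X) (Y - t)) * (indicator {0..X} t *\<^sub>R ((Y - t) * u t)))
        \<in> borel_measurable ?\<nu>"
      by (intro borel_measurable_times) measurable
    have "1 / max (Y - X) (Y - t) \<le> 1 / (Y - X)" for t
      using Y by (intro divide_left_mono) auto
    then show "AE t in ?\<nu>. norm (1 / max (Y - X) (Y - t) * (indicator {0..X} t *\<^sub>R ((Y - t) * u t)))
        \<le> norm (1 / (Y - X) * (indicator {0..X} t *\<^sub>R ((Y - t) * u t)))"
      unfolding norm_mult using Y
      by (intro always_eventually allI mult_right_mono) (auto simp: le_max_iff_disj)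
  qed
  moreover have "(1 / max (Y - X) (Y - t)) * (indicator {0..X} t *\<^sub>R ((Y - t) * u t))
      = indicator {0..X} t *\<^sub>R u t" for t
    using Y by (auto simp: indicator_def max_def)
  ultimately have iu: "set_integrable ?\<nu> {0..X} u" unfolding set_integrable_def by simp
  define C where "C = (LINT t:{0..X}|?\<nu>. \<bar>u t\<bar>)"
  have iabs: "set_integrable ?\<nu> {0..X} (\<lambda>t. \<bar>u t\<bar>)" using set_integrable_abs[OF iu] .
  have "C \<ge> 0" unfolding C_def set_lebesgue_integral_def by (intro integral_nonneg_AE) auto
  let ?G = "\<lambda>x. LINT t:{0..X}|?\<nu>. max 0 (x - t) * u t"
  have rep: "u x = a + b * x - z * ?G x" and iG: "set_integrable ?\<nu> {0..X} (\<lambda>t. max 0 (x - t) * u t)"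
    if x: "x \<in> {0..X}" for x
  proof -
    have eq: "indicator {0..x} t *\<^sub>R ((x - t) * u t) = indicator {0..X} t *\<^sub>R (max 0 (x - t) * u t)" for t
      using x by (auto simp: indicator_def max_def)
    show "u x = a + b * x - z * ?G x"
      using string_solution_integral(2)[OF M s _ _ Y(2), of x] x Y
      unfolding set_lebesgue_integral_def eq by simp
    show "set_integrable ?\<nu> {0..X} (\<lambda>t. max 0 (x - t) * u t)"
      using string_solution_integral(1)[OF M s _ _ Y(2), of x] x Y
      unfolding set_integrable_def eq by simp
  qed
  have "\<bar>?G x - ?G y\<bar> \<le> C * \<bar>x - y\<bar>" if xy: "x \<in> {0..X}" "y \<in> {0..X}" for x y
  proof -
    have "?G x - ?G y = (LINT t:{0..X}|?\<nu>. max 0 (x - t) * u t - max 0 (y - t) * u t)"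
      using set_integral_diff(2)[OF iG[OF xy(1)] iG[OF xy(2)]] by simp
    also have "\<bar>\<dots>\<bar> \<le> (LINT t:{0..X}|?\<nu>. \<bar>x - y\<bar> * \<bar>u t\<bar>)"
    proof -
      have "norm (LINT t:{0..X}|?\<nu>. max 0 (x - t) * u t - max 0 (y - t) * u t)
         \<le> (LINT t:{0..X}|?\<nu>. norm (max 0 (x - t) * u t - max 0 (y - t) * u t))"
        using set_integral_diff(1)[OF iG[OF xy(1)] iG[OF xy(2)]]
        by (intro set_integral_norm_bound)
      also have "\<dots> \<le> (LINT t:{0..X}|?\<nu>. \<bar>x - y\<bar> * \<bar>u t\<bar>)"
      proof (rule set_integral_mono)
        show "set_integrable ?\<nu> {0..X} (\<lambda>t. norm (max 0 (x - t) * u t - max 0 (y - t) * u t))"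
          using set_integrable_abs[OF set_integral_diff(1)[OF iG[OF xy(1)] iG[OF xy(2)]]] by simp
        show "set_integrable ?\<nu> {0..X} (\<lambda>t. \<bar>x - y\<bar> * \<bar>u t\<bar>)" using iabs by simp
        show "norm (max 0 (x - t) * u t - max 0 (y - t) * u t) \<le> \<bar>x - y\<bar> * \<bar>u t\<bar>" for t
          unfolding left_diff_distrib[symmetric] real_norm_def abs_mult by (intro mult_right_mono) auto
      qed
      finally show ?thesis by simp
    qed
    finally show ?thesis unfolding C_def by (simp add: mult.commute)
  qed
  then have "C-lipschitz_on {0..X} ?G"
    using \<open>C \<ge> 0\<close> by (auto simp: lipschitz_on_def dist_real_def)
  then have "continuous_on {0..X} ?G" by (rule lipschitz_on_continuous_on)
  then have "continuous_on {0..X} (\<lambda>x. a + b * x - z * ?G x)" by (intro continuous_intros)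
  then show ?thesis using rep by (subst continuous_on_cong[OF refl]) auto
qed

text \<open>A first zero cannot exist. This replaces Gronwall-type estimates: in the equation, the value
  at \<open>x\<close> depends on the values before \<open>x\<close> only, because the kernel vanishes at \<open>t = x\<close>.\<close>

lemma continuous_positivity_induct:
  fixes v :: "real \<Rightarrow> real"
  assumes cont: "continuous_on {0..X} v"
    and step: "\<And>x. 0 \<le> x \<Longrightarrow> x \<le> X \<Longrightarrow> (\<And>t. 0 \<le> t \<Longrightarrow> t < x \<Longrightarrow> 0 < v t) \<Longrightarrow> 0 < v x"
    and x: "0 \<le> x" "x \<le> X"
  shows "0 < v x"
proof (rule ccontr)
  assume "\<not> 0 < v x"
  define S where "S = {0..X} \<inter> v -` {..0}"
  have "closed S" unfolding S_def using cont by (intro continuous_closed_preimage) auto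
  then have "compact S" by (simp add: S_def compact_eq_bounded_closed bounded_Int)
  moreover have "S \<noteq> {}" using x \<open>\<not> 0 < v x\<close> by (auto simp: S_def)
  ultimately obtain y where y: "y \<in> S" "\<And>t. t \<in> S \<Longrightarrow> y \<le> t"
    using compact_attains_inf[of S] by blast
  have "0 < v t" if "0 \<le> t" "t < y" for t
    using y that unfolding S_def by force
  then have "0 < v y" using step[of y] y by (auto simp: S_def)
  then show False using y(1) by (simp add: S_def)
qed

text \<open>While the solution is positive, the integral term can only increase it.\<close>

lemma string_solution_ge_affine:
  assumes M: "krein_string M" and \<mu>: "\<mu> \<ge> 0" and s: "string_solution M (-\<mu>) a b u"
    and a: "a > 0" and b: "b \<ge> 0" and x: "0 \<le> x" "ennreal x < string_length M"
  shows "u x \<ge> a + b * x"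
proof -
  have ge: "u y \<ge> a + b * y" if y: "0 \<le> y" "y \<le> x" and pos: "\<And>t. 0 \<le> t \<Longrightarrow> t < y \<Longrightarrow> 0 < u t" for y
  proof -
    have "0 \<le> (LINT t:{0..y}|string_measure M x. (y - t) * u t)"
      unfolding set_lebesgue_integral_def
    proof (intro integral_nonneg_AE always_eventually allI)
      fix t
      show "0 \<le> indicator {0..y} t *\<^sub>R ((y - t) * u t)"
        using pos[of t] by (cases "t = y") (auto simp: indicator_def)
    qed
    then show ?thesis using string_solution_integral(2)[OF M s y x(2)] \<mu> by simp
  qed
  have pos: "u y > 0" if "0 \<le> y" "y \<le> x" for y
  proof (rule continuous_positivity_induct[OF string_solution_continuous[OF M s x] _ that])
    fix y assume "0 \<le> y" "y \<le> x" "\<And>t. 0 \<le> t \<Longrightarrow> t < y \<Longrightarrow> 0 < u t"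
    from ge[OF this] show "0 < u y" using a b \<open>0 \<le> y\<close>
      by (meson add_pos_nonneg less_le_trans mult_nonneg_nonneg)
  qed
  show ?thesis using ge[OF x(1) order_refl] pos x by simp
qed

lemma string_solution_phi_ge_1:
  assumes "krein_string M" "\<mu> \<ge> 0" "string_solution M (-\<mu>) 1 0 \<phi>" "0 \<le> x" "ennreal x < string_length M"
  shows "\<phi> x \<ge> 1"
  using string_solution_ge_affine[OF assms(1-3) _ _ assms(4,5)] by simp

text \<open>\<open>\<psi>\<close> starts at \<open>0\<close>, where positivity induction cannot start; the solution \<open>\<psi> + e \<phi>\<close> starts at
  \<open>e > 0\<close>.\<close>

lemma string_solution_psi_ge:
  assumes M: "krein_string M" and \<mu>: "\<mu> \<ge> 0" and \<phi>: "string_solution M (-\<mu>) 1 0 \<phi>"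
    and \<psi>: "string_solution M (-\<mu>) 0 1 \<psi>" and x: "0 \<le> x" "ennreal x < string_length M"
  shows "\<psi> x \<ge> x"
proof -
  have \<phi>1: "\<phi> x \<ge> 1" by (rule string_solution_phi_ge_1[OF M \<mu> \<phi> x])
  have "x \<le> \<psi> x + e * \<phi> x" if "e > 0" for e
    using string_solution_ge_affine[OF M \<mu> string_solution_lincomb[OF \<psi> \<phi>, of 1 e] _ _ x] that
    by simp
  from this[of "e / \<phi> x" for e] have "x \<le> \<psi> x + e" if "e > 0" for e
    using that \<phi>1 by force
  then show ?thesis by (rule field_le_epsilon)
qed

section \<open>Comparison estimates for large parameters\<close>

text \<open>Applied to \<open>v = \<psi> - 2 e \<phi>\<close>, this bounds \<open>\<psi> / \<phi>\<close> by \<open>2 e\<close>. With slope \<open>1\<close> the solution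
  reaches at most \<open>-e\<close> at the point \<open>e\<close>; by then the mass on \<open>[0,e]\<close>, multiplied by \<open>\<mu>\<close>, has bent it
  down so strongly that its slope is no longer positive.\<close>

lemma solution_stays_negative:
  assumes M: "krein_string M" and \<mu>: "\<mu> > 0" and e: "e > 0" "ennreal e < string_length M"
    and large: "\<mu> * e * enn2real (M (ennreal e)) \<ge> 1"
    and v: "string_solution M (-\<mu>) (- 2 * e) 1 v" and x: "0 \<le> x" "ennreal x < string_length M"
  shows "v x < 0"
proof -
  interpret finite_borel_measure "string_measure M x" by (rule finite_borel_string_measure[OF M x])
  let ?\<nu> = "string_measure M x"
  have "0 < - v x"
  proof (rule continuous_positivity_induct[OF _ _ x(1) order_refl])
    show "continuous_on {0..x} (\<lambda>x. - v x)"
      by (intro continuous_intros string_solution_continuous[OF M v x])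
    fix y assume y: "0 \<le> y" "y \<le> x" and "\<And>t. 0 \<le> t \<Longrightarrow> t < y \<Longrightarrow> 0 < - v t"
    then have neg: "\<And>t. 0 \<le> t \<Longrightarrow> t < y \<Longrightarrow> v t < 0" by (metis neg_0_less_iff_less)
    have upper: "v t \<le> - 2 * e + t" if "0 \<le> t" "t \<le> y" for t
    proof -
      have "0 \<le> (LINT r:{0..t}|?\<nu>. - ((t - r) * v r))"
        unfolding set_lebesgue_integral_def
      proof (intro integral_nonneg_AE always_eventually allI)
        fix r
        show "0 \<le> indicator {0..t} r *\<^sub>R (- ((t - r) * v r))"
          using neg[of r] that by (cases "r = t") (auto simp: indicator_def mult_nonneg_nonpos)
      qed
      then have "(LINT r:{0..t}|?\<nu>. (t - r) * v r) \<le> 0"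
        unfolding set_lebesgue_integral_def by simp
      moreover have "v t = - 2 * e + t + \<mu> * (LINT r:{0..t}|?\<nu>. (t - r) * v r)"
        using string_solution_integral(2)[OF M v that(1) _ x(2)] that y by simp
      ultimately show ?thesis using \<mu> by (simp add: mult_nonneg_nonpos)
    qed
    \<comment> \<open>beyond \<open>e\<close>, the integral over \<open>[0,e]\<close>, where \<open>v \<le> -e\<close>, outweighs the linear growth\<close>
    show "0 < - v y"
    proof (cases "y \<le> e")
      case True
      then show ?thesis using upper[of y] y e by simp
    next
      case False
      have "(LINT t:{0..y}|?\<nu>. (y - t) * v t) \<le> (LINT t:{0..y}|?\<nu>. - e * (y - e) * indicator {0..e} t)"
      proof (rule set_integral_mono)
        show "set_integrable ?\<nu> {0..y} (\<lambda>t. (y - t) * v t)"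
          by (rule string_solution_integral(1)[OF M v y x(2)])
        show "set_integrable ?\<nu> {0..y} (\<lambda>t. - e * (y - e) * indicator {0..e} t)"
          unfolding set_integrable_def
          by (intro integrable_mult_indicator integrable_mult_right integrable_real_indicator)
             (auto simp: emeasure_eq_measure)
        fix t assume t: "t \<in> {0..y}"
        show "(y - t) * v t \<le> - e * (y - e) * indicator {0..e} t"
        proof (cases "t \<le> e")
          case True
          have "v t \<le> - e" using upper[of t] t True by simp
          then have "(y - t) * v t \<le> (y - t) * (- e)" using t by (intro mult_left_mono) auto
          also have "\<dots> \<le> (y - e) * (- e)" using True e by (simp add: mult_right_mono)
          finally show ?thesis using True t by (simp add: mult.commute)
        next
          case False
          then have "(y - t) * v t \<le> 0" using neg[of t] t by (cases "t = y") (auto simp: mult_nonneg_nonpos)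
          then show ?thesis using False by simp
        qed
      qed
      also have "\<dots> = - e * (y - e) * (LINT t:{0..y}|?\<nu>. indicator {0..e} t)"
        by (rule set_integral_mult_right)
      also have "(LINT t:{0..y}|?\<nu>. indicator {0..e} t) = measure ?\<nu> {0..e}"
      proof -
        have "(\<lambda>t. indicator {0..y} t *\<^sub>R indicator {0..e} t) = (indicator {0..e} :: real \<Rightarrow> real)"
          using False by (auto simp: indicator_def)
        then show ?thesis unfolding set_lebesgue_integral_def by simp
      qed
      also have "measure ?\<nu> {0..e} = enn2real (M (ennreal e))"
        using measure_string_measure[OF M x, of e] e False y by (simp add: min_def)
      finally have "\<mu> * (LINT t:{0..y}|?\<nu>. (y - t) * v t) \<le> \<mu> * (- e * (y - e) * enn2real (M (ennreal e)))"
        using \<mu> by (intro mult_left_mono) auto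
      also have "\<dots> = - (y - e) * (\<mu> * e * enn2real (M (ennreal e)))" by (simp add: algebra_simps)
      also have "\<dots> \<le> - (y - e) * 1" using large False by (intro mult_left_mono_neg) auto
      finally have "v y \<le> - e"
        using string_solution_integral(2)[OF M v y x(2)] by simp
      then show ?thesis using e by simp
    qed
  qed
  then show ?thesis by simp
qed

text \<open>Applied to \<open>v = \<psi> - k \<phi>\<close>, this shows that \<open>\<psi> / \<phi> \<ge> k\<close> beyond \<open>8 k\<close>. The claimed lower bound
  \<open>x / 4 - 2 k\<close> is negative only before \<open>8 k\<close>, so by induction only the mass up to \<open>8 k\<close> can pull \<open>v\<close>
  down. This costs at most half of the slope, so that \<open>v \<ge> x / 2 - k\<close>.\<close>

lemma solution_becomes_positive:
  assumes M: "krein_string M" and \<mu>: "\<mu> > 0" and k: "k > 0" "ennreal (8 * k) < string_length M"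
    and small: "4 * \<mu> * k * enn2real (M (ennreal (8 * k))) \<le> 1"
    and v: "string_solution M (-\<mu>) (- k) 1 v" and x: "0 \<le> x" "ennreal x < string_length M"
  shows "v x > x / 4 - 2 * k"
proof -
  interpret finite_borel_measure "string_measure M x" by (rule finite_borel_string_measure[OF M x])
  let ?\<nu> = "string_measure M x"
  have "0 < v x - x / 4 + 2 * k"
  proof (rule continuous_positivity_induct[OF _ _ x(1) order_refl])
    show "continuous_on {0..x} (\<lambda>x. v x - x / 4 + 2 * k)"
      by (intro continuous_intros string_solution_continuous[OF M v x]) auto
    fix y assume y: "0 \<le> y" "y \<le> x" and "\<And>t. 0 \<le> t \<Longrightarrow> t < y \<Longrightarrow> 0 < v t - t / 4 + 2 * k"
    then have lower: "\<And>t. 0 \<le> t \<Longrightarrow> t < y \<Longrightarrow> v t > t / 4 - 2 * k" by force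
    have "(LINT t:{0..y}|?\<nu>. - 2 * k * y * indicator {0..8*k} t) \<le> (LINT t:{0..y}|?\<nu>. (y - t) * v t)"
    proof (rule set_integral_mono)
      show "set_integrable ?\<nu> {0..y} (\<lambda>t. (y - t) * v t)"
        by (rule string_solution_integral(1)[OF M v y x(2)])
      show "set_integrable ?\<nu> {0..y} (\<lambda>t. - 2 * k * y * indicator {0..8*k} t)"
        unfolding set_integrable_def
        by (intro integrable_mult_indicator integrable_mult_right integrable_real_indicator)
           (auto simp: emeasure_eq_measure)
      fix t assume t: "t \<in> {0..y}"
      consider "t = y" | "t < y" "t > 8 * k" | "t < y" "t \<le> 8 * k" using t by force
      then show "- 2 * k * y * indicator {0..8*k} t \<le> (y - t) * v t"
      proof cases
        case 1
        then show ?thesis using k y by (simp add: indicator_def)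
      next
        case 2
        then have "v t > 0" using lower[of t] t by simp
        then show ?thesis using 2 by simp
      next
        case 3
        have "(y - t) * (- 2 * k) \<le> (y - t) * v t"
          using lower[of t] t 3 by (intro mult_left_mono) auto
        moreover have "- 2 * k * y \<le> (y - t) * (- 2 * k)" using t k by (simp add: algebra_simps)
        ultimately show ?thesis using 3 t by simp
      qed
    qed
    also have "(LINT t:{0..y}|?\<nu>. - 2 * k * y * indicator {0..8*k} t)
        = - 2 * k * y * (LINT t:{0..y}|?\<nu>. indicator {0..8*k} t)"
      by (rule set_integral_mult_right)
    also have "(LINT t:{0..y}|?\<nu>. indicator {0..8*k} t) = measure ?\<nu> {0..min y (8*k)}"
    proof -
      have "(\<lambda>t. indicator {0..y} t *\<^sub>R indicator {0..8*k} t) = (indicator {0..min y (8*k)} :: real \<Rightarrow> real)"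
        by (auto simp: indicator_def)
      then show ?thesis unfolding set_lebesgue_integral_def by simp
    qed
    finally have "- 2 * k * y * measure ?\<nu> {0..min y (8*k)} \<le> (LINT t:{0..y}|?\<nu>. (y - t) * v t)" .
    moreover have "measure ?\<nu> {0..min y (8*k)} \<le> enn2real (M (ennreal (8 * k)))"
    proof -
      have "measure ?\<nu> {0..min y (8*k)} = enn2real (M (ennreal (min (min y (8*k)) x)))"
        using y k by (intro measure_string_measure[OF M x]) auto
      also have "\<dots> \<le> enn2real (M (ennreal (8 * k)))"
        using krein_string_finite_iff[OF M, of "ennreal (8 * k)"] k
        by (intro enn2real_mono krein_string_mono[OF M] ennreal_leI) auto
      finally show ?thesis .
    qed
    ultimately have "- 2 * k * y * enn2real (M (ennreal (8 * k))) \<le> (LINT t:{0..y}|?\<nu>. (y - t) * v t)"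
      using y k by (smt (verit) mult_left_mono mult_nonneg_nonneg mult_minus_left)
    then have "\<mu> * (- 2 * k * y * enn2real (M (ennreal (8 * k)))) \<le> \<mu> * (LINT t:{0..y}|?\<nu>. (y - t) * v t)"
      using \<mu> by (intro mult_left_mono) auto
    moreover have "\<mu> * (- 2 * k * y * enn2real (M (ennreal (8 * k))))
        = - (y / 2) * (4 * \<mu> * k * enn2real (M (ennreal (8 * k))))" by (simp add: algebra_simps)
    moreover have "- (y / 2) * (4 * \<mu> * k * enn2real (M (ennreal (8 * k)))) \<ge> - (y / 2) * 1"
      using small y by (intro mult_left_mono_neg) auto
    ultimately have "v y \<ge> - k + y / 2"
      using string_solution_integral(2)[OF M v y x(2)] by simp
    then show "0 < v y - y / 4 + 2 * k" using k y by simp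
  qed
  then show ?thesis by simp
qed

section \<open>The characteristic function on the negative half-line\<close>

lemma eventually_left_limit_filter:
  assumes "L > 0"
  shows "eventually P (left_limit_filter L)
    \<longleftrightarrow> (\<exists>a\<ge>0. ennreal a < L \<and> (\<forall>x. a < x \<longrightarrow> ennreal x < L \<longrightarrow> P x))"
proof (cases "L = \<infinity>")
  case True
  have "(\<exists>N. \<forall>n>N. P n) \<longleftrightarrow> (\<exists>a\<ge>0. \<forall>x>a. P x)"
  proof
    assume "\<exists>N. \<forall>n>N. P n"
    then obtain N where "\<forall>n>N. P n" by blast
    then show "\<exists>a\<ge>0. \<forall>x>a. P x" by (intro exI[of _ "max 0 N"]) auto
  qed blast
  then show ?thesis using True eventually_at_top_dense[of P] unfolding left_limit_filter_def by simp
next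
  case False
  then obtain l where l: "L = ennreal l" "l > 0"
    using assms by (cases L) auto
  have "(\<exists>b<l. \<forall>y>b. y < l \<longrightarrow> P y) \<longleftrightarrow> (\<exists>a\<ge>0. a < l \<and> (\<forall>x. a < x \<longrightarrow> x < l \<longrightarrow> P x))"
  proof
    assume "\<exists>b<l. \<forall>y>b. y < l \<longrightarrow> P y"
    then obtain b where "b < l" "\<forall>y>b. y < l \<longrightarrow> P y" by blast
    then show "\<exists>a\<ge>0. a < l \<and> (\<forall>x. a < x \<longrightarrow> x < l \<longrightarrow> P x)"
      using l(2) by (intro exI[of _ "max 0 b"]) auto
  qed blast
  moreover have "(a < l \<and> (\<forall>x. a < x \<longrightarrow> x < l \<longrightarrow> P x))
     \<longleftrightarrow> (ennreal a < L \<and> (\<forall>x. a < x \<longrightarrow> ennreal x < L \<longrightarrow> P x))" if "a \<ge> 0" for a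
    using that by (auto simp: l(1) ennreal_less_iff)
  moreover have "left_limit_filter L = at_left l"
    using False l by (simp add: left_limit_filter_def)
  ultimately show ?thesis using eventually_at_left[of 0 l P] l(2) by (simp cong: conj_cong)
qed

lemma left_limit_filter_nontrivial: "L > 0 \<Longrightarrow> left_limit_filter L \<noteq> bot"
  unfolding left_limit_filter_def by (simp add: trivial_limit_at_top_linorder)

lemma filtermap_left_limit_filter:
  assumes "c \<ge> 0" "L > 0"
  shows "filtermap (\<lambda>x. x + c) (left_limit_filter L) = left_limit_filter (ennreal c + L)"
proof (rule filter_eqI)
  fix P
  have L': "ennreal c + L > 0" using assms(2) by (metis add_pos_nonneg add.commute zero_le)
  show "eventually P (filtermap (\<lambda>x. x + c) (left_limit_filter L))
      \<longleftrightarrow> eventually P (left_limit_filter (ennreal c + L))"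
    unfolding eventually_filtermap eventually_left_limit_filter[OF assms(2)] eventually_left_limit_filter[OF L']
  proof
    assume "\<exists>a\<ge>0. ennreal a < L \<and> (\<forall>x>a. ennreal x < L \<longrightarrow> P (x + c))"
    then obtain a where a: "a \<ge> 0" "ennreal a < L" "\<And>x. x > a \<Longrightarrow> ennreal x < L \<Longrightarrow> P (x + c)" by blast
    have "P x" if "x > a + c" "ennreal x < ennreal c + L" for x
      using a(3)[of "x - c"] that add_less_ennreal_iff[of "x - c" c L] a(1) assms by simp
    then show "\<exists>a\<ge>0. ennreal a < ennreal c + L \<and> (\<forall>x>a. ennreal x < ennreal c + L \<longrightarrow> P x)"
      using a assms add_less_ennreal_iff[of a c L] by (intro exI[of _ "a + c"]) auto
  next
    assume "\<exists>a\<ge>0. ennreal a < ennreal c + L \<and> (\<forall>x>a. ennreal x < ennreal c + L \<longrightarrow> P x)"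
    then obtain a where a: "a \<ge> 0" "ennreal a < ennreal c + L"
      "\<And>x. x > a \<Longrightarrow> ennreal x < ennreal c + L \<Longrightarrow> P x" by blast
    have "ennreal (max 0 (a - c)) < L"
      using a assms add_less_ennreal_iff[of "a - c" c L] by (auto simp: max_def)
    moreover have "P (x + c)" if "x > max 0 (a - c)" "ennreal x < L" for x
      using a(3)[of "x + c"] that add_less_ennreal_iff[of x c L] assms by auto
    ultimately show "\<exists>a\<ge>0. ennreal a < L \<and> (\<forall>x>a. ennreal x < L \<longrightarrow> P (x + c))"
      by (intro exI[of _ "max 0 (a - c)"]) auto
  qed
qed

text \<open>The value at \<open>-\<mu>\<close> as an extended nonnegative number. In this form the string without any mass
  has the value \<open>\<infinity>\<close>, so that gaps and masses can be removed until nothing is left.\<close>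

definition characteristic_value :: "(ennreal \<Rightarrow> ennreal) \<Rightarrow> real \<Rightarrow> ennreal \<Rightarrow> bool" where
  "characteristic_value M \<mu> w \<longleftrightarrow>
     (if string_length M = 0 then w = 0
      else \<exists>\<phi> \<psi>. string_solution M (-\<mu>) 1 0 \<phi> \<and> string_solution M (-\<mu>) 0 1 \<psi> \<and>
        ((\<lambda>x. ennreal (\<psi> x / \<phi> x)) \<longlongrightarrow> w) (left_limit_filter (string_length M)))"

lemma characteristic_valueE:
  assumes "characteristic_value M \<mu> w" "string_length M > 0"
  obtains \<phi> \<psi> where "string_solution M (-\<mu>) 1 0 \<phi>" "string_solution M (-\<mu>) 0 1 \<psi>"
    "((\<lambda>x. ennreal (\<psi> x / \<phi> x)) \<longlongrightarrow> w) (left_limit_filter (string_length M))"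
proof -
  have "string_length M \<noteq> 0" using assms(2) by simp
  with assms(1) that show ?thesis unfolding characteristic_value_def by (simp only: if_False) blast
qed

lemma characteristic_valueI:
  assumes "string_solution M (-\<mu>) 1 0 \<phi>" "string_solution M (-\<mu>) 0 1 \<psi>"
    "((\<lambda>x. ennreal (\<psi> x / \<phi> x)) \<longlongrightarrow> w) (left_limit_filter (string_length M))" "string_length M > 0"
  shows "characteristic_value M \<mu> w"
proof -
  have "string_length M \<noteq> 0" using assms(4) by simp
  with assms(1-3) show ?thesis unfolding characteristic_value_def by (simp only: if_False) blast
qed

lemma eventually_left_limit_filterI:
  assumes "L > 0" "\<And>x. 0 < x \<Longrightarrow> ennreal x < L \<Longrightarrow> P x"
  shows "eventually P (left_limit_filter L)"
  unfolding eventually_left_limit_filter[OF assms(1)] using assms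
  by (intro exI[of _ 0]) auto

lemma delay_0: "delay 0 M = M"
  by (auto simp: delay_def)

lemma tendsto_inverse_ennreal:
  fixes f :: "'a \<Rightarrow> ennreal"
  assumes "(f \<longlongrightarrow> l) F"
  shows "((\<lambda>x. inverse (f x)) \<longlongrightarrow> inverse l) F"
  by (rule continuous_on_tendsto_compose[OF continuous_on_inverse_ennreal[OF continuous_on_id, of UNIV] assms]) auto

lemma inverse_inverse_ennreal [simp]: "inverse (inverse x) = (x::ennreal)"
proof (cases x)
  case (real r)
  then show ?thesis by (cases "r = 0") (auto simp: inverse_ennreal)
qed simp

lemma tendsto_left_limit_filter_id:
  "c > 0 \<Longrightarrow> (ennreal \<longlongrightarrow> ennreal c) (left_limit_filter (ennreal c))"
  by (auto simp: left_limit_filter_def intro!: tendsto_ennrealI)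

text \<open>If \<open>\<phi>'\<close> and \<open>\<psi>'\<close> are the fundamental solutions of the string after the gap, then
  \<open>\<phi>(x + c) = \<phi>'(x)\<close> and \<open>\<psi>(x + c) = \<psi>'(x) + c \<phi>'(x)\<close>.\<close>

lemma characteristic_value_delay:
  assumes M: "krein_string M" and c: "c \<ge> 0" and \<mu>: "\<mu> \<ge> 0"
  shows "characteristic_value (delay c M) \<mu> w
    \<longleftrightarrow> (\<exists>w'. w = ennreal c + w' \<and> characteristic_value M \<mu> w')"
proof (cases "c = 0")
  case True
  then show ?thesis by (simp add: delay_0)
next
  case False
  then have c: "c > 0" using c by simp
  note M' = krein_string_delay[OF M, of c]
  have len: "string_length (delay c M) = ennreal c + string_length M"
    by (rule string_length_delay[OF M])
  then have L': "string_length (delay c M) > 0" using c by (simp add: add_pos_nonneg)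
  note sol = string_solution_delay[OF M less_imp_le[OF c]]
  show ?thesis
  proof (cases "string_length M = 0")
    case True
    have triv: "string_solution M z a b u" for z a b u
      using True by (simp add: string_solution_def)
    have len_c: "string_length (delay c M) = ennreal c" using True len by simp
    have lim: "((\<lambda>x. ennreal (\<psi> x / \<phi> x)) \<longlongrightarrow> ennreal c) (left_limit_filter (ennreal c))"
      if "\<forall>x. 0 \<le> x \<longrightarrow> x < c \<longrightarrow> \<phi> x = 1" "\<forall>x. 0 \<le> x \<longrightarrow> x < c \<longrightarrow> \<psi> x = x" for \<phi> \<psi>
    proof (rule Lim_transform_eventually[OF tendsto_left_limit_filter_id[OF c]])
      show "eventually (\<lambda>x. ennreal x = ennreal (\<psi> x / \<phi> x)) (left_limit_filter (ennreal c))"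
        using c that by (intro eventually_left_limit_filterI) (auto simp: ennreal_less_iff)
    qed
    have "characteristic_value (delay c M) \<mu> w \<longleftrightarrow> w = ennreal c"
    proof
      assume cv: "characteristic_value (delay c M) \<mu> w"
      obtain \<phi> \<psi> where "string_solution (delay c M) (-\<mu>) 1 0 \<phi>" "string_solution (delay c M) (-\<mu>) 0 1 \<psi>"
        and *: "((\<lambda>x. ennreal (\<psi> x / \<phi> x)) \<longlongrightarrow> w) (left_limit_filter (ennreal c))"
        unfolding len_c[symmetric] by (rule characteristic_valueE[OF cv L'])
      then have "((\<lambda>x. ennreal (\<psi> x / \<phi> x)) \<longlongrightarrow> ennreal c) (left_limit_filter (ennreal c))"
        unfolding sol by (intro lim) auto
      then show "w = ennreal c"
        using tendsto_unique[OF _ *] left_limit_filter_nontrivial[of "ennreal c"] c by simp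
    next
      assume "w = ennreal c"
      moreover have "string_solution (delay c M) (-\<mu>) 1 0 (\<lambda>x. 1)"
        "string_solution (delay c M) (-\<mu>) 0 1 (\<lambda>x. x)"
        unfolding sol by (auto intro: triv)
      ultimately show "characteristic_value (delay c M) \<mu> w"
        using lim[of "\<lambda>_. 1" "\<lambda>x. x"] L' len_c by (intro characteristic_valueI) auto
    qed
    then show ?thesis using True by (simp add: characteristic_value_def)
  next
    case False
    then have L: "string_length M > 0" by (simp add: zero_less_iff_neq_zero)
    let ?F = "left_limit_filter (string_length M)"
    note nontriv = left_limit_filter_nontrivial[OF L]
    have filter: "left_limit_filter (string_length (delay c M)) = filtermap (\<lambda>x. x + c) ?F"
      unfolding len using filtermap_left_limit_filter[OF less_imp_le[OF c] L] by simp
    have key: "eventually (\<lambda>x. ennreal ((\<psi> x + c * \<phi> x) / \<phi> x) = ennreal c + ennreal (\<psi> x / \<phi> x)) ?F"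
      if s: "string_solution M (-\<mu>) 1 0 \<phi>" "string_solution M (-\<mu>) 0 1 \<psi>" for \<phi> \<psi>
    proof (rule eventually_left_limit_filterI[OF L])
      fix x :: real assume x: "0 < x" "ennreal x < string_length M"
      have "\<phi> x \<ge> 1" "\<psi> x \<ge> x"
        using string_solution_phi_ge_1[OF M \<mu> s(1) _ x(2)] string_solution_psi_ge[OF M \<mu> s _ x(2)] x by auto
      then show "ennreal ((\<psi> x + c * \<phi> x) / \<phi> x) = ennreal c + ennreal (\<psi> x / \<phi> x)"
        using x c by (subst ennreal_plus[symmetric]) (auto simp: add_divide_distrib add.commute)
    qed
    show ?thesis
    proof
      assume "characteristic_value (delay c M) \<mu> w"
      then obtain \<phi> \<psi> where s: "string_solution (delay c M) (-\<mu>) 1 0 \<phi>" "string_solution (delay c M) (-\<mu>) 0 1 \<psi>"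
        and lim: "((\<lambda>x. ennreal (\<psi> x / \<phi> x)) \<longlongrightarrow> w) (filtermap (\<lambda>x. x + c) ?F)"
        unfolding filter[symmetric] by (rule characteristic_valueE[OF _ L'])
      define \<phi>' \<psi>' where "\<phi>' = (\<lambda>x. \<phi> (x + c))" and "\<psi>' = (\<lambda>x. \<psi> (x + c) - c * \<phi> (x + c))"
      have s': "string_solution M (-\<mu>) 1 0 \<phi>'" "string_solution M (-\<mu>) 0 1 \<psi>'"
        using s string_solution_lincomb[of M "-\<mu>" c 1 "\<lambda>x. \<psi> (x + c)" 1 0 "\<lambda>x. \<phi> (x + c)" 1 "- c"]
        unfolding sol \<phi>'_def \<psi>'_def by simp_all
      have "\<psi> (x + c) = \<psi>' x + c * \<phi>' x" "\<phi> (x + c) = \<phi>' x" for x by (simp_all add: \<phi>'_def \<psi>'_def)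
      then have "((\<lambda>x. ennreal ((\<psi>' x + c * \<phi>' x) / \<phi>' x)) \<longlongrightarrow> w) ?F"
        using lim by (simp add: filterlim_filtermap)
      then have lim': "((\<lambda>x. ennreal c + ennreal (\<psi>' x / \<phi>' x)) \<longlongrightarrow> w) ?F"
        by (rule Lim_transform_eventually[OF _ key[OF s']])
      have "((\<lambda>x. (ennreal c + ennreal (\<psi>' x / \<phi>' x)) - ennreal c) \<longlongrightarrow> w - ennreal c) ?F"
        by (intro tendsto_diff_ennreal_general lim' tendsto_const) auto
      then have "characteristic_value M \<mu> (w - ennreal c)"
        by (intro characteristic_valueI[OF s' _ L]) simp
      moreover have "ennreal c \<le> w"
        by (rule tendsto_lowerbound[OF lim' _ nontriv]) (auto intro!: always_eventually)
      ultimately show "\<exists>w'. w = ennreal c + w' \<and> characteristic_value M \<mu> w'"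
        by (intro exI[of _ "w - ennreal c"]) (simp add: add_diff_inverse_ennreal)
    next
      assume "\<exists>w'. w = ennreal c + w' \<and> characteristic_value M \<mu> w'"
      then obtain w' where w: "w = ennreal c + w'" and w': "characteristic_value M \<mu> w'" by blast
      obtain \<phi>' \<psi>' where s': "string_solution M (-\<mu>) 1 0 \<phi>'" "string_solution M (-\<mu>) 0 1 \<psi>'"
        and lim: "((\<lambda>x. ennreal (\<psi>' x / \<phi>' x)) \<longlongrightarrow> w') ?F"
        by (rule characteristic_valueE[OF w' L])
      define \<phi> \<psi> where "\<phi> = (\<lambda>x. if x < c then 1 else \<phi>' (x - c))"
        and "\<psi> = (\<lambda>x. if x < c then x else \<psi>' (x - c) + c * \<phi>' (x - c))"
      have later: "string_solution M z a b (\<lambda>x. if x < 0 then f x else u x)" if "string_solution M z a b u"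
        for z a b f u
      proof -
        have "set_integrable (string_measure M x) {0..x} (\<lambda>t. (x - t) * (if t < 0 then f t else u t))
            \<longleftrightarrow> set_integrable (string_measure M x) {0..x} (\<lambda>t. (x - t) * u t)" for x
          by (rule set_integrable_cong) auto
        moreover have "(LINT t:{0..x}|string_measure M x. (x - t) * (if t < 0 then f t else u t))
            = (LINT t:{0..x}|string_measure M x. (x - t) * u t)" for x
          by (rule set_lebesgue_integral_cong) auto
        ultimately show ?thesis using that unfolding string_solution_def by simp
      qed
      \<comment> \<open>after translation the formula for the gap covers \<open>x < 0\<close>, where solutions are arbitrary\<close>
      have shifted: "(\<lambda>x. \<phi> (x + c)) = (\<lambda>x. if x < 0 then 1 else \<phi>' x)"
        "(\<lambda>x. \<psi> (x + c)) = (\<lambda>x. if x < 0 then x + c else 1 * \<psi>' x + c * \<phi>' x)"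
        by (auto simp: fun_eq_iff \<phi>_def \<psi>_def)
      have "string_solution (delay c M) (-\<mu>) 1 0 \<phi>"
        using later[OF s'(1), of "\<lambda>_. 1"] unfolding sol shifted by (simp add: \<phi>_def)
      moreover have "string_solution (delay c M) (-\<mu>) 0 1 \<psi>"
        using later[OF string_solution_lincomb[OF s'(2,1), of 1 c], of "\<lambda>x. x + c"]
        unfolding sol shifted by (simp add: \<psi>_def)
      moreover have "((\<lambda>x. ennreal (\<psi> x / \<phi> x)) \<longlongrightarrow> w) (filtermap (\<lambda>x. x + c) ?F)"
      proof -
        have "eventually (\<lambda>x. ennreal c + ennreal (\<psi>' x / \<phi>' x) = ennreal (\<psi> (x + c) / \<phi> (x + c))) ?F"
        proof -
          have "eventually (\<lambda>x. 0 < x) ?F" by (rule eventually_left_limit_filterI[OF L])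
          with key[OF s'] show ?thesis
          proof eventually_elim
            case (elim x)
            then have "\<psi> (x + c) = \<psi>' x + c * \<phi>' x" "\<phi> (x + c) = \<phi>' x"
              by (simp_all add: \<phi>_def \<psi>_def)
            with elim(1) show ?case by (simp only:)
          qed
        qed
        moreover have "((\<lambda>x. ennreal c + ennreal (\<psi>' x / \<phi>' x)) \<longlongrightarrow> w) ?F"
          unfolding w by (intro tendsto_add tendsto_const lim)
        ultimately show ?thesis
          unfolding filterlim_filtermap by (rule Lim_transform_eventually[rotated])
      qed
      ultimately show "characteristic_value (delay c M) \<mu> w"
        unfolding filter[symmetric] by (intro characteristic_valueI L')
    qed
  qed
qed

text \<open>The mass leaves \<open>\<psi>\<close> unchanged and replaces \<open>\<phi>\<close> by \<open>\<phi> + \<mu> m \<psi>\<close>.\<close>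

lemma characteristic_value_add_mass:
  assumes M: "krein_string M" and m: "m \<ge> 0" and \<mu>: "\<mu> \<ge> 0"
  shows "characteristic_value (add_mass m M) \<mu> w
    \<longleftrightarrow> (\<exists>w'. w = inverse (ennreal (\<mu> * m) + inverse w') \<and> characteristic_value M \<mu> w')"
proof (cases "string_length M = 0")
  case True
  then have "characteristic_value (add_mass m M) \<mu> w \<longleftrightarrow> w = 0"
    "characteristic_value M \<mu> w' \<longleftrightarrow> w' = 0" for w'
    by (simp_all only: characteristic_value_def string_length_add_mass[OF M] if_True simp_thms)
  then show ?thesis by simp
next
  case False
  then have L: "string_length M > 0" by (simp add: zero_less_iff_neq_zero)
  let ?F = "left_limit_filter (string_length M)"
  note nontriv = left_limit_filter_nontrivial[OF L]
  note len = string_length_add_mass[OF M, of m]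
  note sol = string_solution_add_mass[OF M m]
  have key: "eventually (\<lambda>x. ennreal (\<psi> x / (\<phi> x + \<mu> * m * \<psi> x))
       = inverse (ennreal (\<mu> * m) + inverse (ennreal (\<psi> x / \<phi> x)))) ?F"
    if s: "string_solution M (-\<mu>) 1 0 \<phi>" "string_solution M (-\<mu>) 0 1 \<psi>" for \<phi> \<psi>
  proof (rule eventually_left_limit_filterI[OF L])
    fix x :: real assume x: "0 < x" "ennreal x < string_length M"
    have "\<phi> x \<ge> 1" "\<psi> x \<ge> x"
      using string_solution_phi_ge_1[OF M \<mu> s(1) _ x(2)] string_solution_psi_ge[OF M \<mu> s _ x(2)] x by auto
    then have pos: "\<phi> x > 0" "\<psi> x > 0" using x by auto
    then have pos': "\<mu> * m + inverse (\<psi> x / \<phi> x) > 0" using \<mu> m by (simp add: add_nonneg_pos)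
    have "inverse (ennreal (\<mu> * m) + inverse (ennreal (\<psi> x / \<phi> x)))
        = ennreal (inverse (\<mu> * m + inverse (\<psi> x / \<phi> x)))"
      using pos pos' \<mu> m by (simp add: inverse_ennreal flip: ennreal_plus)
    also have "inverse (\<mu> * m + inverse (\<psi> x / \<phi> x)) = \<psi> x / (\<phi> x + \<mu> * m * \<psi> x)"
      using pos by (simp add: field_simps)
    finally show "ennreal (\<psi> x / (\<phi> x + \<mu> * m * \<psi> x))
       = inverse (ennreal (\<mu> * m) + inverse (ennreal (\<psi> x / \<phi> x)))" by simp
  qed
  show ?thesis
  proof
    assume cv: "characteristic_value (add_mass m M) \<mu> w"
    obtain \<phi> \<psi> where s: "string_solution (add_mass m M) (-\<mu>) 1 0 \<phi>" "string_solution (add_mass m M) (-\<mu>) 0 1 \<psi>"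
      and lim: "((\<lambda>x. ennreal (\<psi> x / \<phi> x)) \<longlongrightarrow> w) ?F"
      using characteristic_valueE[OF cv] L unfolding len by blast
    define \<phi>' where "\<phi>' = (\<lambda>x. \<phi> x - \<mu> * m * \<psi> x)"
    have s': "string_solution M (-\<mu>) 1 0 \<phi>'" "string_solution M (-\<mu>) 0 1 \<psi>"
      using s string_solution_lincomb[of M "-\<mu>" 1 "\<mu> * m" \<phi> 0 1 \<psi> 1 "- (\<mu> * m)"]
      unfolding sol \<phi>'_def by simp_all
    have "\<phi> = (\<lambda>x. \<phi>' x + \<mu> * m * \<psi> x)" by (simp add: \<phi>'_def)
    then have lim': "((\<lambda>x. inverse (ennreal (\<mu> * m) + inverse (ennreal (\<psi> x / \<phi>' x)))) \<longlongrightarrow> w) ?F"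
      using lim by (intro Lim_transform_eventually[OF _ key[OF s']]) simp
    from tendsto_inverse_ennreal[OF this]
    have lim'': "((\<lambda>x. ennreal (\<mu> * m) + inverse (ennreal (\<psi> x / \<phi>' x))) \<longlongrightarrow> inverse w) ?F"
      by simp
    have "((\<lambda>x. ennreal (\<mu> * m) + inverse (ennreal (\<psi> x / \<phi>' x)) - ennreal (\<mu> * m))
       \<longlongrightarrow> inverse w - ennreal (\<mu> * m)) ?F"
      by (intro tendsto_diff_ennreal_general lim'' tendsto_const) auto
    from tendsto_inverse_ennreal[OF this]
    have "((\<lambda>x. ennreal (\<psi> x / \<phi>' x)) \<longlongrightarrow> inverse (inverse w - ennreal (\<mu> * m))) ?F"
      by simp
    then have "characteristic_value M \<mu> (inverse (inverse w - ennreal (\<mu> * m)))"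
      by (rule characteristic_valueI[OF s' _ L])
    moreover have "ennreal (\<mu> * m) \<le> inverse w"
      by (rule tendsto_lowerbound[OF lim'' _ nontriv]) (auto intro!: always_eventually)
    moreover from this have "w = inverse (ennreal (\<mu> * m) + inverse (inverse (inverse w - ennreal (\<mu> * m))))"
      by (simp only: inverse_inverse_ennreal add_diff_inverse_ennreal)
    ultimately show "\<exists>w'. w = inverse (ennreal (\<mu> * m) + inverse w') \<and> characteristic_value M \<mu> w'"
      by blast
  next
    assume "\<exists>w'. w = inverse (ennreal (\<mu> * m) + inverse w') \<and> characteristic_value M \<mu> w'"
    then obtain w' where w: "w = inverse (ennreal (\<mu> * m) + inverse w')"
      and w': "characteristic_value M \<mu> w'" by blast
    obtain \<phi>' \<psi> where s': "string_solution M (-\<mu>) 1 0 \<phi>'" "string_solution M (-\<mu>) 0 1 \<psi>"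
      and lim: "((\<lambda>x. ennreal (\<psi> x / \<phi>' x)) \<longlongrightarrow> w') ?F"
      by (rule characteristic_valueE[OF w' L])
    define \<phi> where "\<phi> = (\<lambda>x. \<phi>' x + \<mu> * m * \<psi> x)"
    have "string_solution (add_mass m M) (-\<mu>) 1 0 \<phi>" "string_solution (add_mass m M) (-\<mu>) 0 1 \<psi>"
      using string_solution_lincomb[OF s', of 1 "\<mu> * m"] s' unfolding sol \<phi>_def by simp_all
    moreover have "((\<lambda>x. ennreal (\<psi> x / \<phi> x)) \<longlongrightarrow> w) ?F"
    proof (rule Lim_transform_eventually)
      show "((\<lambda>x. inverse (ennreal (\<mu> * m) + inverse (ennreal (\<psi> x / \<phi>' x)))) \<longlongrightarrow> w) ?F"
        unfolding w by (intro tendsto_inverse_ennreal tendsto_add tendsto_const lim)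
      show "eventually (\<lambda>x. inverse (ennreal (\<mu> * m) + inverse (ennreal (\<psi> x / \<phi>' x)))
          = ennreal (\<psi> x / \<phi> x)) ?F"
        using key[OF s'] by eventually_elim (simp add: \<phi>_def)
    qed
    ultimately show "characteristic_value (add_mass m M) \<mu> w"
      using L by (intro characteristic_valueI) (simp_all add: len)
  qed
qed

lemma obtain_real_between_0:
  assumes "(0::ennreal) < y" "(r::real) > 0"
  obtains e where "e > 0" "e \<le> r" "ennreal e < y"
proof -
  obtain z where z: "0 < z" "z < min y (ennreal r)"
    using dense[of 0 "min y (ennreal r)"] assms by auto
  then obtain e where "z = ennreal e" "e \<ge> 0" by (cases z) auto
  with z assms show ?thesis by (intro that[of e]) (auto simp: ennreal_less_iff)
qed

text \<open>However small the mass \<open>q\<close> of \<open>[0,d]\<close> is, \<open>\<mu> d q \<ge> 1\<close> for large \<open>\<mu>\<close>, and then the ratio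
  \<open>\<psi> / \<phi>\<close> never exceeds \<open>2 d\<close>.\<close>

lemma characteristic_value_tendsto_0:
  assumes M: "krein_string M" and pos: "\<And>x. x > 0 \<Longrightarrow> M x > 0" and e: "e > 0"
  obtains \<mu>\<^sub>0 where "\<mu>\<^sub>0 > 0" "\<And>\<mu> w. \<mu> > \<mu>\<^sub>0 \<Longrightarrow> characteristic_value M \<mu> w \<Longrightarrow> w \<le> ennreal e"
proof (cases "string_length M = 0")
  case True
  then show ?thesis by (intro that[of 1]) (auto simp: characteristic_value_def)
next
  case False
  then have L: "string_length M > 0" by (simp add: zero_less_iff_neq_zero)
  then obtain d where d: "d > 0" "d \<le> e / 2" "ennreal d < string_length M"
    using obtain_real_between_0[of "string_length M" "e / 2"] e by auto
  define q where "q = enn2real (M (ennreal d))"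
  have "q > 0"
    unfolding q_def using pos[of "ennreal d"] d krein_string_finite_iff[OF M, of "ennreal d"]
    by (auto simp: enn2real_positive_iff)
  have "w \<le> ennreal e" if \<mu>: "\<mu> > 1 / (d * q)" and w: "characteristic_value M \<mu> w" for \<mu> w
  proof -
    have \<mu>0: "\<mu> > 0" using \<mu> d \<open>q > 0\<close> by (meson divide_pos_pos less_trans mult_pos_pos zero_less_one)
    obtain \<phi> \<psi> where s: "string_solution M (-\<mu>) 1 0 \<phi>" "string_solution M (-\<mu>) 0 1 \<psi>"
      and lim: "((\<lambda>x. ennreal (\<psi> x / \<phi> x)) \<longlongrightarrow> w) (left_limit_filter (string_length M))"
      by (rule characteristic_valueE[OF w L])
    have "eventually (\<lambda>x. ennreal (\<psi> x / \<phi> x) \<le> ennreal e) (left_limit_filter (string_length M))"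
    proof (rule eventually_left_limit_filterI[OF L])
      fix x :: real assume x: "0 < x" "ennreal x < string_length M"
      have "\<phi> x \<ge> 1" using string_solution_phi_ge_1[OF M _ s(1) _ x(2)] x \<mu>0 by simp
      moreover have "\<psi> x - 2 * d * \<phi> x < 0"
        using solution_stays_negative[OF M \<mu>0 d(1,3) _ _ _ x(2), of "\<lambda>x. \<psi> x - 2 * d * \<phi> x"]
          string_solution_lincomb[OF s(2,1), of 1 "- 2 * d"] x \<mu> d \<open>q > 0\<close>
        by (simp add: q_def[symmetric] field_simps)
      ultimately have "\<psi> x / \<phi> x \<le> 2 * d" by (simp add: field_simps)
      then show "ennreal (\<psi> x / \<phi> x) \<le> ennreal e" using d by (intro ennreal_leI) simp
    qed
    then show ?thesis
      by (rule tendsto_upperbound[OF lim _ left_limit_filter_nontrivial[OF L]])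
  qed
  moreover have "1 / (d * q) > 0" using d \<open>q > 0\<close> by simp
  ultimately show ?thesis using that by blast
qed

text \<open>Without an atom at the origin, the mass near the origin is as small as desired, and eventually
  \<open>\<psi>\<close> exceeds \<open>K / \<mu>\<close> times \<open>\<phi>\<close>, whatever \<open>K\<close> is.\<close>

lemma characteristic_value_lower_bound:
  assumes M: "krein_string M" and L: "string_length M > 0" and M0: "M 0 = 0" and K: "K > 0"
  obtains \<mu>\<^sub>0 where "\<mu>\<^sub>0 > 0"
    "\<And>\<mu> w. \<mu> > \<mu>\<^sub>0 \<Longrightarrow> characteristic_value M \<mu> w \<Longrightarrow> ennreal (K / \<mu>) \<le> w"
proof -
  have "M 0 < ennreal (1 / (4 * K))" using M0 K by simp
  moreover have "\<forall>y>M 0. \<exists>z>0. M z < y"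
    using M unfolding krein_string_iff by auto
  ultimately obtain z where z: "z > 0" "M z < ennreal (1 / (4 * K))" by blast
  obtain d where d: "d > 0" "ennreal d < min z (string_length M)"
    using obtain_real_between_0[of "min z (string_length M)" 1] z L by auto
  have Md: "enn2real (M (ennreal d)) \<le> 1 / (4 * K)"
    using krein_string_mono[OF M, of "ennreal d" z] d z K
    by (intro enn2real_leI) (auto intro: order_trans[OF _ less_imp_le])
  have "ennreal (K / \<mu>) \<le> w" if \<mu>: "\<mu> > 8 * K / d" and w: "characteristic_value M \<mu> w" for \<mu> w
  proof -
    have \<mu>0: "\<mu> > 0" using \<mu> d K by (meson divide_pos_pos less_trans mult_pos_pos zero_less_numeral)
    define k where "k = K / \<mu>"
    have k: "k > 0" "8 * k \<le> d" using K \<mu>0 \<mu> d by (auto simp: k_def field_simps)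
    then have kL: "ennreal (8 * k) < string_length M"
      using d by (metis ennreal_leI le_less_trans min_less_iff_conj)
    have "enn2real (M (ennreal (8 * k))) \<le> enn2real (M (ennreal d))"
      using krein_string_finite_iff[OF M, of "ennreal d"] d k
      by (intro enn2real_mono krein_string_mono[OF M] ennreal_leI) auto
    then have "enn2real (M (ennreal (8 * k))) \<le> 1 / (4 * K)" using Md by simp
    then have small: "4 * \<mu> * k * enn2real (M (ennreal (8 * k))) \<le> 1"
      using K \<mu>0 by (simp add: k_def field_simps)
    obtain \<phi> \<psi> where s: "string_solution M (-\<mu>) 1 0 \<phi>" "string_solution M (-\<mu>) 0 1 \<psi>"
      and lim: "((\<lambda>x. ennreal (\<psi> x / \<phi> x)) \<longlongrightarrow> w) (left_limit_filter (string_length M))"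
      by (rule characteristic_valueE[OF w L])
    have "eventually (\<lambda>x. ennreal k \<le> ennreal (\<psi> x / \<phi> x)) (left_limit_filter (string_length M))"
      unfolding eventually_left_limit_filter[OF L]
    proof (intro exI[of _ "8 * k"] conjI allI impI)
      fix x assume x: "8 * k < x" "ennreal x < string_length M"
      then have x0: "x \<ge> 0" using k by simp
      have "\<phi> x \<ge> 1" using string_solution_phi_ge_1[OF M _ s(1) x0 x(2)] \<mu>0 by simp
      moreover have "\<psi> x - k * \<phi> x > x / 4 - 2 * k"
        using solution_becomes_positive[OF M \<mu>0 k(1) kL small _ x0 x(2), of "\<lambda>x. \<psi> x - k * \<phi> x"]
          string_solution_lincomb[OF s(2,1), of 1 "- k"] by simp
      ultimately have "k \<le> \<psi> x / \<phi> x" using x by (simp add: field_simps)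
      then show "ennreal k \<le> ennreal (\<psi> x / \<phi> x)" by (rule ennreal_leI)
    qed (use k kL in auto)
    then show ?thesis unfolding k_def
      by (rule tendsto_lowerbound[OF lim _ left_limit_filter_nontrivial[OF L]])
  qed
  moreover have "8 * K / d > 0" using d K by simp
  ultimately show ?thesis using that by blast
qed

section \<open>Removing the leading gap or mass\<close>

text \<open>An infinite gap without mass. Its value is \<open>\<infinity>\<close>, so it has no complex-valued characteristic
  function.\<close>

definition empty_string :: "ennreal \<Rightarrow> ennreal" where
  "empty_string x = (if x = \<infinity> then \<infinity> else 0)"

lemma krein_string_empty: "krein_string empty_string"
  unfolding krein_string_iff
proof (intro conjI allI impI)
  show "mono empty_string"
    by (auto simp: mono_def empty_string_def top_unique)
  fix x y :: ennreal assume "x < \<infinity>" "empty_string x < y"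
  moreover obtain z where "x < z" "z < \<infinity>" using dense[OF \<open>x < \<infinity>\<close>] by blast
  ultimately show "\<exists>z>x. empty_string z < y"
    by (intro exI[of _ z]) (auto simp: empty_string_def split: if_splits)
qed (simp add: empty_string_def)

lemma string_length_empty: "string_length empty_string = \<infinity>"
  by (rule string_length_eqI[OF krein_string_empty]) (auto simp: empty_string_def)

lemma krein_string_top: "krein_string (\<lambda>_. \<infinity>)"
  unfolding krein_string_iff by (auto simp: mono_def)

lemma string_length_top: "string_length (\<lambda>_. \<infinity>) = 0"
  by (rule string_length_eqI[OF krein_string_top]) auto

lemma characteristic_value_empty: "characteristic_value empty_string \<mu> \<infinity>"
proof -
  have sol: "string_solution empty_string z a b (\<lambda>x. a + b * x)" for z a b
    unfolding string_solution_def
  proof (intro allI impI)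
    fix x :: real assume x: "0 \<le> x" "ennreal x < string_length empty_string"
    note null = string_integral_no_mass[OF krein_string_empty x]
    show "set_integrable (string_measure empty_string x) {0..x} (\<lambda>t. (x - t) * (a + b * t)) \<and>
      a + b * x = a + b * x - z * (LINT t:{0..x}|string_measure empty_string x. (x - t) * (a + b * t))"
      using null(1)[of "\<lambda>t. (x - t) * (a + b * t)"] null(2)[of "\<lambda>t. (x - t) * (a + b * t)"]
      by (simp add: empty_string_def)
  qed
  have "((\<lambda>x. ennreal (x / 1)) \<longlongrightarrow> \<infinity>) at_top"
    using filterlim_ident[of at_top] by (simp add: ennreal_tendsto_top_eq_at_top)
  then show ?thesis
    using sol[of "-\<mu>" 1 0] sol[of "-\<mu>" 0 1]
    by (intro characteristic_valueI[of _ _ "\<lambda>_. 1" "\<lambda>x. x"])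
       (simp_all add: string_length_empty left_limit_filter_def)
qed

text \<open>An infinite gap starts with a gap of any given length, so \<open>w\<close> exceeds every number.\<close>

lemma characteristic_value_empty_unique:
  assumes "characteristic_value empty_string \<mu> w" "\<mu> \<ge> 0"
  shows "w = \<infinity>"
proof -
  have "ennreal c \<le> w" if "c \<ge> 0" for c
  proof -
    have "delay c empty_string = empty_string"
      by (auto simp: delay_def empty_string_def fun_eq_iff)
    then obtain w' where "w = ennreal c + w'"
      using characteristic_value_delay[OF krein_string_empty \<open>c \<ge> 0\<close> assms(2), of w] assms(1) by auto
    then show "ennreal c \<le> w" by simp
  qed
  from this[of "enn2real w + 1"] show ?thesis
    by (cases w) (auto simp: enn2real_nonneg simp del: ennreal_plus)
qed

text \<open>The gap ends at the supremum of the points up to which there is no mass.\<close>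

lemma string_decompose_delay:
  assumes M: "krein_string M" and ne: "M \<noteq> empty_string"
  obtains c M' where "c \<ge> 0" "krein_string M'" "M = delay c M'" "\<And>x. x > 0 \<Longrightarrow> M' x > 0"
proof -
  define C where "C = Sup {x. M x = 0}"
  have below: "M x = 0" if x: "x < C" for x
  proof -
    obtain y where "x < y" "M y = 0" using x unfolding C_def less_Sup_iff by auto
    then show ?thesis using krein_string_mono[OF M, of x y] by simp
  qed
  have above: "M x > 0" if "x > C" for x
    using that unfolding C_def by (metis Sup_upper leD mem_Collect_eq zero_less_iff_neq_zero)
  have "C \<noteq> \<infinity>"
  proof
    assume "C = \<infinity>"
    then have "M = empty_string"
      using below M by (auto simp: empty_string_def fun_eq_iff krein_string_iff less_top[symmetric])
    then show False using ne by simp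
  qed
  then obtain c where c: "C = ennreal c" "c \<ge> 0" by (cases C) auto
  define M' where "M' = (\<lambda>x. M (ennreal c + x))"
  show ?thesis
  proof (rule that[of c M'])
    show "c \<ge> 0" by fact
    show "M = delay c M'"
      using below by (auto simp: fun_eq_iff delay_def M'_def c add_diff_inverse_ennreal not_less)
    show "M' x > 0" if "x > 0" for x
    proof -
      have "ennreal c + 0 < ennreal c + x" using that by (subst ennreal_add_left_cancel_less) auto
      then show ?thesis unfolding M'_def using above c by simp
    qed
    show "krein_string M'"
      unfolding krein_string_iff
    proof (intro conjI allI impI)
      show "mono M'" using krein_string_mono[OF M] by (auto simp: mono_def M'_def add_left_mono)
      show "M' \<infinity> = \<infinity>" using M by (simp add: M'_def krein_string_iff)
      fix x y assume x: "x < \<infinity>" "M' x < y"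
      then have "ennreal c + x < \<infinity>" by simp
      then obtain z where z: "z > ennreal c + x" "M z < y"
        using M x unfolding krein_string_iff M'_def by blast
      have "ennreal c \<le> z" using z(1) by (metis le_iff_add less_imp_le order_trans)
      then have z': "ennreal c + (z - ennreal c) = z" by (simp add: add_diff_inverse_ennreal)
      then have "z - ennreal c > x" using z(1) by (metis add_left_mono leD not_le)
      then show "\<exists>z>x. M' z < y" using z z' unfolding M'_def by metis
    qed
  qed
qed

lemma string_decompose_mass:
  assumes M: "krein_string M" and fin: "M 0 < \<infinity>"
  obtains m M' where "m \<ge> 0" "krein_string M'" "M = add_mass m M'" "M' 0 = 0"
proof -
  obtain m where m: "M 0 = ennreal m" "m \<ge> 0" using fin by (cases "M 0") auto
  have ge: "ennreal m \<le> M x" for x using krein_string_mono[OF M, of 0 x] m by simp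
  define M' where "M' = (\<lambda>x. M x - ennreal m)"
  show ?thesis
  proof (rule that[of m M'])
    show "m \<ge> 0" "M' 0 = 0" using m by (simp_all add: M'_def)
    show "M = add_mass m M'"
      using ge by (simp add: fun_eq_iff add_mass_def M'_def add_diff_inverse_ennreal)
    show "krein_string M'"
      unfolding krein_string_iff
    proof (intro conjI allI impI)
      show "mono M'" using krein_string_mono[OF M] by (auto simp: mono_def M'_def ennreal_minus_mono)
      show "M' \<infinity> = \<infinity>" using M by (simp add: M'_def krein_string_iff)
      fix x y assume x: "x < \<infinity>" "M' x < y"
      then have "M x < ennreal m + y" unfolding M'_def by (simp add: ennreal_diff_less_iff[OF ge])
      then obtain z where "z > x" "M z < ennreal m + y" using M x unfolding krein_string_iff by blast
      then show "\<exists>z>x. M' z < y" unfolding M'_def by (auto simp: ennreal_diff_less_iff[OF ge])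
    qed
  qed
qed

section \<open>Strings of finitely many beads\<close>

text \<open>The list alternates between gaps and masses; the flag tells whether it starts with a gap. A list
  that ends with a mass is followed by an infinite gap, a list that ends with a gap by an infinite
  mass. With this convention the dual string belongs to the same list and the opposite flag.\<close>

fun bead_string :: "bool \<Rightarrow> real list \<Rightarrow> ennreal \<Rightarrow> ennreal" where
  "bead_string True [] = empty_string"
| "bead_string True (l # r) = delay l (bead_string False r)"
| "bead_string False [] = (\<lambda>_. \<infinity>)"
| "bead_string False (m # r) = add_mass m (bead_string True r)"

fun bead_value :: "bool \<Rightarrow> real list \<Rightarrow> real \<Rightarrow> ennreal" where
  "bead_value True [] \<mu> = \<infinity>"
| "bead_value True (l # r) \<mu> = ennreal l + bead_value False r \<mu>"
| "bead_value False [] \<mu> = 0"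
| "bead_value False (m # r) \<mu> = inverse (ennreal (\<mu> * m) + inverse (bead_value True r \<mu>))"

abbreviation all_positive :: "real list \<Rightarrow> bool" where
  "all_positive r \<equiv> (\<forall>a\<in>set r. 0 < a)"

lemma krein_string_bead: "krein_string (bead_string b r)"
  using krein_string_top
  by (induction b r rule: bead_string.induct)
     (auto intro: krein_string_empty krein_string_delay krein_string_add_mass)

lemma characteristic_value_bead:
  assumes "all_positive r" "\<mu> \<ge> 0"
  shows "characteristic_value (bead_string b r) \<mu> (bead_value b r \<mu>)"
  using assms
proof (induction b r rule: bead_string.induct)
  case 1
  then show ?case using characteristic_value_empty by simp
next
  case (2 l r)
  then show ?case using characteristic_value_delay[OF krein_string_bead, of l \<mu> False r] by auto
next
  case 3
  then show ?case using string_length_top by (simp add: characteristic_value_def)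
next
  case (4 m r)
  then show ?case using characteristic_value_add_mass[OF krein_string_bead, of m \<mu> True r] by auto
qed

lemma bead_string_mass_first_pos:
  assumes "all_positive r" "x > 0"
  shows "bead_string False r x > 0"
  using assms by (cases r) (auto simp: add_mass_def add_pos_nonneg)

lemma bead_string_gap_first_0: "all_positive r \<Longrightarrow> bead_string True r 0 = 0"
  by (cases r) (auto simp: empty_string_def delay_def)

lemma bead_string_gap_first_length: "all_positive r \<Longrightarrow> string_length (bead_string True r) > 0"
  by (cases r) (auto simp: string_length_empty string_length_delay[OF krein_string_bead] add_pos_nonneg)

lemma add_eq_small_imp_le:
  assumes "c \<ge> 0" "c' \<ge> 0" and eq: "ennreal c + w = ennreal c' + w'" and w': "w' \<le> ennreal e" "e \<ge> 0"
  shows "c \<le> c' + e"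
proof -
  have "ennreal c \<le> ennreal c' + w'" unfolding eq[symmetric] by simp
  also have "\<dots> \<le> ennreal c' + ennreal e" using w' by (intro add_left_mono) auto
  finally show ?thesis using assms by (simp flip: ennreal_plus)
qed

text \<open>Both \<open>w\<close> and \<open>v\<close> vanish in the limit \<open>\<mu> \<rightarrow> \<infinity>\<close>.\<close>

lemma leading_gap_unique:
  assumes M: "krein_string M" "\<And>x. x > 0 \<Longrightarrow> M x > 0" and c: "c \<ge> 0"
    and N: "krein_string N" "\<And>x. x > 0 \<Longrightarrow> N x > 0" and d: "d \<ge> 0"
    and w: "\<And>\<mu>. \<mu> > 0 \<Longrightarrow> characteristic_value M \<mu> (w \<mu>)"
    and v: "\<And>\<mu>. \<mu> > 0 \<Longrightarrow> characteristic_value N \<mu> (v \<mu>)"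
    and eq: "\<And>\<mu>. \<mu> > 0 \<Longrightarrow> ennreal c + w \<mu> = ennreal d + v \<mu>"
  shows "c = d"
proof -
  have "c \<le> d + e \<and> d \<le> c + e" if e: "e > 0" for e
  proof -
    obtain \<mu>1 where \<mu>1: "\<mu>1 > 0" "\<And>\<mu> w. \<mu> > \<mu>1 \<Longrightarrow> characteristic_value M \<mu> w \<Longrightarrow> w \<le> ennreal e"
      using characteristic_value_tendsto_0[OF M e] by blast
    obtain \<mu>2 where \<mu>2: "\<mu>2 > 0" "\<And>\<mu> w. \<mu> > \<mu>2 \<Longrightarrow> characteristic_value N \<mu> w \<Longrightarrow> w \<le> ennreal e"
      using characteristic_value_tendsto_0[OF N e] by blast
    define \<mu> where "\<mu> = max \<mu>1 \<mu>2 + 1"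
    have \<mu>: "\<mu> > \<mu>1" "\<mu> > \<mu>2" "\<mu> > 0" using \<mu>1(1) by (auto simp: \<mu>_def)
    have "w \<mu> \<le> ennreal e" "v \<mu> \<le> ennreal e"
      using \<mu>1(2)[OF \<mu>(1) w] \<mu>2(2)[OF \<mu>(2) v] \<mu> by auto
    then show ?thesis
      using add_eq_small_imp_le[OF c d eq] add_eq_small_imp_le[OF d c eq[symmetric]] \<mu> e by auto
  qed
  then show ?thesis by (meson antisym field_le_epsilon)
qed

text \<open>After division by \<open>\<mu>\<close>, the terms \<open>1 / w\<close> and \<open>1 / v\<close> vanish in the limit \<open>\<mu> \<rightarrow> \<infinity>\<close>.\<close>

lemma leading_mass_unique:
  assumes M: "krein_string M" "string_length M > 0" "M 0 = 0" and c: "c \<ge> 0"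
    and N: "krein_string N" "string_length N > 0" "N 0 = 0" and d: "d \<ge> 0"
    and w: "\<And>\<mu>. \<mu> > 0 \<Longrightarrow> characteristic_value M \<mu> (w \<mu>)"
    and v: "\<And>\<mu>. \<mu> > 0 \<Longrightarrow> characteristic_value N \<mu> (v \<mu>)"
    and eq: "\<And>\<mu>. \<mu> > 0 \<Longrightarrow> ennreal (\<mu> * c) + inverse (w \<mu>) = ennreal (\<mu> * d) + inverse (v \<mu>)"
  shows "c = d"
proof -
  have "c \<le> d + e \<and> d \<le> c + e" if e: "e > 0" for e
  proof -
    have e': "1 / e > 0" using e by simp
    obtain \<mu>1 where \<mu>1: "\<mu>1 > 0" "\<And>\<mu> w. \<mu> > \<mu>1 \<Longrightarrow> characteristic_value M \<mu> w \<Longrightarrow> ennreal (1 / e / \<mu>) \<le> w"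
      using characteristic_value_lower_bound[OF M e'] by blast
    obtain \<mu>2 where \<mu>2: "\<mu>2 > 0" "\<And>\<mu> w. \<mu> > \<mu>2 \<Longrightarrow> characteristic_value N \<mu> w \<Longrightarrow> ennreal (1 / e / \<mu>) \<le> w"
      using characteristic_value_lower_bound[OF N e'] by blast
    define \<mu> where "\<mu> = max \<mu>1 \<mu>2 + 1"
    have \<mu>: "\<mu> > \<mu>1" "\<mu> > \<mu>2" "\<mu> > 0" using \<mu>1(1) by (auto simp: \<mu>_def)
    have inv: "inverse w \<le> ennreal (\<mu> * e)" if "ennreal (1 / e / \<mu>) \<le> w" for w
    proof -
      have pos: "1 / e / \<mu> > 0" using e \<mu> by simp
      show ?thesis
      proof (cases w)
        case (real r)
        then have "1 / e / \<mu> \<le> r" using that by simp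
        moreover from this have "r > 0" using pos by (rule less_le_trans[rotated])
        ultimately show ?thesis using real e \<mu> by (auto simp: inverse_ennreal field_simps intro!: ennreal_leI)
      qed simp
    qed
    have "inverse (w \<mu>) \<le> ennreal (\<mu> * e)" "inverse (v \<mu>) \<le> ennreal (\<mu> * e)"
      using inv \<mu>1(2)[OF \<mu>(1) w] \<mu>2(2)[OF \<mu>(2) v] \<mu> by auto
    then have "\<mu> * c \<le> \<mu> * d + \<mu> * e" "\<mu> * d \<le> \<mu> * c + \<mu> * e"
      using add_eq_small_imp_le[OF _ _ eq] add_eq_small_imp_le[OF _ _ eq[symmetric]] \<mu> e c d by auto
    then show ?thesis using \<mu> by (metis distrib_left mult_le_cancel_left_pos)
  qed
  then show ?thesis by (meson antisym field_le_epsilon)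
qed

lemma characteristic_value_eq_0_imp_length_0:
  assumes M: "krein_string M" and w: "\<And>\<mu>. \<mu> > 0 \<Longrightarrow> characteristic_value M \<mu> 0"
  shows "string_length M = 0"
proof (rule ccontr)
  assume L: "string_length M \<noteq> 0"
  then have "M 0 < \<infinity>" by (subst krein_string_finite_iff[OF M]) (auto simp: zero_less_iff_neq_zero)
  then obtain m M' where m: "m \<ge> 0" "krein_string M'" "M = add_mass m M'" "M' 0 = 0"
    using string_decompose_mass[OF M] by blast
  then have L': "string_length M' > 0" using L by (simp add: string_length_add_mass zero_less_iff_neq_zero)
  obtain \<mu>\<^sub>0 where \<mu>\<^sub>0: "\<mu>\<^sub>0 > 0" "\<And>\<mu> w. \<mu> > \<mu>\<^sub>0 \<Longrightarrow> characteristic_value M' \<mu> w \<Longrightarrow> ennreal (1 / \<mu>) \<le> w"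
    using characteristic_value_lower_bound[OF m(2) L' m(4), of 1] by auto
  define \<mu> where "\<mu> = \<mu>\<^sub>0 + 1"
  have \<mu>: "\<mu> > 0" "\<mu> > \<mu>\<^sub>0" using \<mu>\<^sub>0 by (auto simp: \<mu>_def)
  obtain w' where w': "0 = inverse (ennreal (\<mu> * m) + inverse w')" "characteristic_value M' \<mu> w'"
    using w[OF \<mu>(1)] characteristic_value_add_mass[OF m(2,1), of \<mu> 0] \<mu> unfolding m(3) by auto
  then have "w' = 0" by (metis ennreal_add_eq_top ennreal_inverse_eq_0_iff ennreal_inverse_eq_top_iff ennreal_neq_top)
  then show False using \<mu>\<^sub>0(2)[OF \<mu>(2) w'(2)] \<mu> by simp
qed

text \<open>The leading gap or mass of a string is a limit of its characteristic function, and for the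
  characteristic function of a list this limit is the first entry of the list. After both are removed
  the rest has the characteristic function of the remaining list.\<close>

theorem bead_string_unique:
  assumes "all_positive r" "krein_string M"
    and "\<And>\<mu>. \<mu> > 0 \<Longrightarrow> characteristic_value M \<mu> (bead_value b r \<mu>)"
  shows "M = bead_string b r"
  using assms
proof (induction b r arbitrary: M rule: bead_string.induct)
  case 1
  show ?case
  proof (rule ccontr)
    assume "M \<noteq> bead_string True []"
    then obtain c M' where c: "c \<ge> 0" "krein_string M'" "M = delay c M'" "\<And>x. x > 0 \<Longrightarrow> M' x > 0"
      using string_decompose_delay[OF 1(2)] by auto
    obtain \<mu>\<^sub>0 where \<mu>\<^sub>0: "\<mu>\<^sub>0 > 0" "\<And>\<mu> w. \<mu> > \<mu>\<^sub>0 \<Longrightarrow> characteristic_value M' \<mu> w \<Longrightarrow> w \<le> ennreal 1"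
      using characteristic_value_tendsto_0[OF c(2,4), of 1] by auto
    have "\<mu>\<^sub>0 + 1 > 0" using \<mu>\<^sub>0 by simp
    then obtain w' where "\<infinity> = ennreal c + w'" "characteristic_value M' (\<mu>\<^sub>0 + 1) w'"
      using 1(3)[of "\<mu>\<^sub>0 + 1"] characteristic_value_delay[OF c(2,1), of "\<mu>\<^sub>0 + 1" \<infinity>] unfolding c(3) by auto
    moreover from this have "w' \<le> ennreal 1" using \<mu>\<^sub>0(2)[of "\<mu>\<^sub>0 + 1" w'] by simp
    moreover have "w' = \<infinity>"
      using \<open>\<infinity> = ennreal c + w'\<close> by (metis ennreal_add_eq_top ennreal_neq_top infinity_ennreal_def)
    ultimately show False by (simp add: top_unique)
  qed
next
  case (2 l r)
  have l: "l > 0" and r: "all_positive r" using 2(2) by auto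
  have finite: "bead_value True (l # r) \<mu> < \<infinity> \<Longrightarrow> M \<noteq> empty_string" if "\<mu> > 0" for \<mu>
    using 2(4)[OF that] characteristic_value_empty_unique[of \<mu>] that by (metis less_irrefl less_imp_le)
  note N = krein_string_bead[of False r] bead_string_mass_first_pos[OF r]
  have v: "characteristic_value (bead_string False r) \<mu> (bead_value False r \<mu>)" if "\<mu> > 0" for \<mu>
    using characteristic_value_bead[OF r] that by simp
  obtain \<mu>\<^sub>0 where \<mu>\<^sub>0: "\<mu>\<^sub>0 > 0" "\<And>\<mu> w. \<mu> > \<mu>\<^sub>0 \<Longrightarrow> characteristic_value (bead_string False r) \<mu> w \<Longrightarrow> w \<le> ennreal 1"
    using characteristic_value_tendsto_0[OF N, of 1] by auto
  have "bead_value False r (\<mu>\<^sub>0 + 1) \<le> ennreal 1"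
    using \<mu>\<^sub>0(1) by (intro \<mu>\<^sub>0(2)[OF _ v]) auto
  then have "bead_value True (l # r) (\<mu>\<^sub>0 + 1) < \<infinity>"
    by (auto simp: less_top[symmetric] ennreal_add_eq_top top_unique)
  then have "M \<noteq> empty_string" using finite[of "\<mu>\<^sub>0 + 1"] \<mu>\<^sub>0 by simp
  then obtain c M' where c: "c \<ge> 0" "krein_string M'" "M = delay c M'" "\<And>x. x > 0 \<Longrightarrow> M' x > 0"
    using string_decompose_delay[OF 2(3)] by auto
  have "\<exists>w'. ennreal l + bead_value False r \<mu> = ennreal c + w' \<and> characteristic_value M' \<mu> w'" if "\<mu> > 0" for \<mu>
    using 2(4)[OF that] characteristic_value_delay[OF c(2,1), of \<mu>] that unfolding c(3) by simp
  then obtain w where w: "\<And>\<mu>. \<mu> > 0 \<Longrightarrow> ennreal l + bead_value False r \<mu> = ennreal c + w \<mu>"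
    "\<And>\<mu>. \<mu> > 0 \<Longrightarrow> characteristic_value M' \<mu> (w \<mu>)" by metis
  have "l = c"
    by (rule leading_gap_unique[OF N less_imp_le[OF l] c(2,4,1) v w(2,1)]) auto
  then have "characteristic_value M' \<mu> (bead_value False r \<mu>)" if "\<mu> > 0" for \<mu>
    using w[OF that] by (simp add: ennreal_add_left_cancel)
  then have "M' = bead_string False r" using 2(1)[OF r c(2)] by blast
  then show ?case using c(3) \<open>l = c\<close> by simp
next
  case 3
  then have "string_length M = 0" by (intro characteristic_value_eq_0_imp_length_0) auto
  then have "M x = \<infinity>" for x
    using krein_string_finite_iff[OF 3(2), of x] 3(2)
    by (cases "x = \<infinity>") (auto simp: krein_string_iff less_top[symmetric])
  then show ?case by auto
next
  case (4 m r)
  have m: "m > 0" and r: "all_positive r" using 4(2) by auto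
  note N = krein_string_bead[of True r] bead_string_gap_first_length[OF r] bead_string_gap_first_0[OF r]
  have v: "characteristic_value (bead_string True r) \<mu> (bead_value True r \<mu>)" if "\<mu> > 0" for \<mu>
    using characteristic_value_bead[OF r] that by simp
  have L: "string_length M > 0"
  proof (rule ccontr)
    assume "\<not> string_length M > 0"
    then have 0: "inverse (ennreal (\<mu> * m) + inverse (bead_value True r \<mu>)) = 0" if "\<mu> > 0" for \<mu>
      using 4(4)[OF that] by (simp add: characteristic_value_def)
    have "bead_value True r \<mu> = 0" if "\<mu> > 0" for \<mu>
      using 0[OF that] by (auto simp: ennreal_add_eq_top)
    then have "string_length (bead_string True r) = 0"
      using v N(1) by (intro characteristic_value_eq_0_imp_length_0) auto
    then show False using N(2) by simp
  qed
  then have "M 0 < \<infinity>" by (subst krein_string_finite_iff[OF 4(3)]) auto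
  then obtain c M' where c: "c \<ge> 0" "krein_string M'" "M = add_mass c M'" "M' 0 = 0"
    using string_decompose_mass[OF 4(3)] by blast
  have L': "string_length M' > 0" using L by (simp add: c(3) string_length_add_mass[OF c(2)])
  have "\<exists>w'. inverse (ennreal (\<mu> * m) + inverse (bead_value True r \<mu>)) = inverse (ennreal (\<mu> * c) + inverse w')
      \<and> characteristic_value M' \<mu> w'" if "\<mu> > 0" for \<mu>
    using 4(4)[OF that] characteristic_value_add_mass[OF c(2,1), of \<mu>] that unfolding c(3) by simp
  then have "\<exists>w'. ennreal (\<mu> * m) + inverse (bead_value True r \<mu>) = ennreal (\<mu> * c) + inverse w'
      \<and> characteristic_value M' \<mu> w'" if "\<mu> > 0" for \<mu>
    using that by (metis inverse_inverse_ennreal)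
  then obtain w where w: "\<And>\<mu>. \<mu> > 0 \<Longrightarrow> ennreal (\<mu> * m) + inverse (bead_value True r \<mu>) = ennreal (\<mu> * c) + inverse (w \<mu>)"
    "\<And>\<mu>. \<mu> > 0 \<Longrightarrow> characteristic_value M' \<mu> (w \<mu>)" by metis
  have "m = c"
    by (rule leading_mass_unique[OF N less_imp_le[OF m] c(2) L' c(4,1) v w(2,1)]) auto
  then have "characteristic_value M' \<mu> (bead_value True r \<mu>)" if "\<mu> > 0" for \<mu>
  proof -
    have "inverse (bead_value True r \<mu>) = inverse (w \<mu>)"
      using w(1)[OF that] \<open>m = c\<close> by (simp add: ennreal_add_left_cancel)
    then have "inverse (inverse (bead_value True r \<mu>)) = inverse (inverse (w \<mu>))" by (rule arg_cong)
    then show ?thesis using w(2)[OF that] by simp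
  qed
  then have "M' = bead_string True r" using 4(1)[OF r c(2)] by blast
  then show ?case using c(3) \<open>m = c\<close> by simp
qed

section \<open>From values on the half-line to characteristic functions\<close>

text \<open>Positivity of \<open>g\<close> rules out length \<open>0\<close>, and the ratios \<open>\<psi> / \<phi>\<close> are nonnegative. Hence nothing
  is lost by taking the limit in the extended nonnegative numbers.\<close>

lemma has_characteristic_function_iff:
  assumes M: "krein_string M" and hol: "W holomorphic_on (- (complex_of_real ` {0..}))"
    and W: "\<And>\<mu>. \<mu> > 0 \<Longrightarrow> g \<mu> > 0 \<and> W (complex_of_real (-\<mu>)) = complex_of_real (g \<mu>)"
  shows "has_characteristic_function M W \<longleftrightarrow> (\<forall>\<mu>>0. characteristic_value M \<mu> (ennreal (g \<mu>)))"
proof -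
  let ?P = "\<lambda>z. if string_length M = 0 then W (complex_of_real z) = 0
        else \<exists>\<phi> \<psi>. string_solution M z 1 0 \<phi> \<and> string_solution M z 0 1 \<psi> \<and>
               ((\<lambda>x. complex_of_real (\<psi> x / \<phi> x)) \<longlongrightarrow> W (complex_of_real z))
                 (left_limit_filter (string_length M))"
  have "?P (-\<mu>) \<longleftrightarrow> characteristic_value M \<mu> (ennreal (g \<mu>))" if \<mu>: "\<mu> > 0" for \<mu>
  proof (cases "string_length M = 0")
    case True
    have "g \<mu> > 0" "W (complex_of_real (-\<mu>)) = complex_of_real (g \<mu>)" using W[OF \<mu>] by auto
    then have "W (complex_of_real (-\<mu>)) \<noteq> 0" "ennreal (g \<mu>) \<noteq> 0" by simp_all
    then show ?thesis using True unfolding characteristic_value_def by simp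
  next
    case False
    then have L: "string_length M > 0" by (simp add: zero_less_iff_neq_zero)
    have lim: "((\<lambda>x. complex_of_real (\<psi> x / \<phi> x)) \<longlongrightarrow> W (complex_of_real (-\<mu>))) (left_limit_filter (string_length M))
      \<longleftrightarrow> ((\<lambda>x. ennreal (\<psi> x / \<phi> x)) \<longlongrightarrow> ennreal (g \<mu>)) (left_limit_filter (string_length M))"
      if s: "string_solution M (-\<mu>) 1 0 \<phi>" "string_solution M (-\<mu>) 0 1 \<psi>" for \<phi> \<psi>
    proof -
      have nonneg: "eventually (\<lambda>x. 0 \<le> \<psi> x / \<phi> x) (left_limit_filter (string_length M))"
      proof (rule eventually_left_limit_filterI[OF L])
        fix x :: real assume x: "0 < x" "ennreal x < string_length M"
        have "\<phi> x \<ge> 1" "\<psi> x \<ge> x"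
          using string_solution_phi_ge_1[OF M _ s(1) _ x(2)] string_solution_psi_ge[OF M _ s _ x(2)] x \<mu> by auto
        then show "0 \<le> \<psi> x / \<phi> x" using x by simp
      qed
      have "W (complex_of_real (-\<mu>)) = complex_of_real (g \<mu>)" "0 \<le> g \<mu>" using W[OF \<mu>] by auto
      then show ?thesis
        unfolding \<open>W _ = _\<close> tendsto_of_real_iff by (intro tendsto_ennreal_iff[OF nonneg, symmetric])
    qed
    show ?thesis using False unfolding characteristic_value_def
      by (simp only: if_False) (use lim in blast)
  qed
  note at = this
  have "(\<forall>z<0. ?P z) \<longleftrightarrow> (\<forall>\<mu>>0. ?P (-\<mu>))"
  proof (intro iffI allI impI)
    fix \<mu> :: real assume "\<forall>z<0. ?P z" "\<mu> > 0"
    then show "?P (-\<mu>)" by (elim allE[of _ "-\<mu>"]) (simp only: neg_less_0_iff_less simp_thms)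
  next
    fix z :: real assume "\<forall>\<mu>>0. ?P (-\<mu>)" "z < 0"
    then show "?P z" by (elim allE[of _ "-z"]) (simp only: neg_0_less_iff_less minus_minus simp_thms)
  qed
  also have "\<dots> \<longleftrightarrow> (\<forall>\<mu>>0. characteristic_value M \<mu> (ennreal (g \<mu>)))"
    using at by blast
  finally have "(\<forall>z<0. ?P z) \<longleftrightarrow> (\<forall>\<mu>>0. characteristic_value M \<mu> (ennreal (g \<mu>)))" .
  then show ?thesis unfolding has_characteristic_function_def using hol by blast
qed

section \<open>Duality\<close>

text \<open>The right-continuous inverse exchanges the horizontal and the vertical axis, so a gap becomes a
  mass at the origin.\<close>

lemma dual_string_delay: "dual_string (delay l M) = add_mass l (dual_string M)"
proof
  fix y
  show "dual_string (delay l M) y = add_mass l (dual_string M) y"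
  proof (cases "y = \<infinity>")
    case True
    then show ?thesis by (simp add: dual_string_def add_mass_def)
  next
    case False
    have "Inf {t. y < delay l M t} = ennreal l + Inf {t. y < M t}" (is "?A = _")
    proof (rule antisym)
      have "?A - ennreal l \<le> t" if "y < M t" for t
      proof -
        have "y < delay l M (ennreal l + t)" using that by (simp add: delay_def)
        then have "?A \<le> ennreal l + t" by (intro Inf_lower) simp
        then show ?thesis by (simp add: ennreal_minus_le_iff)
      qed
      then have "?A - ennreal l \<le> Inf {t. y < M t}" by (intro Inf_greatest) auto
      then show "?A \<le> ennreal l + Inf {t. y < M t}" by (simp add: ennreal_minus_le_iff)
    next
      show "ennreal l + Inf {t. y < M t} \<le> ?A"
      proof (intro Inf_greatest)
        fix t assume "t \<in> {t. y < delay l M t}"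
        then have t: "ennreal l \<le> t" "y < M (t - ennreal l)"
          by (auto simp: delay_def split: if_splits)
        have "ennreal l + Inf {t. y < M t} \<le> ennreal l + (t - ennreal l)"
          using t(2) by (intro add_left_mono Inf_lower) simp
        then show "ennreal l + Inf {t. y < M t} \<le> t"
          using t(1) by (simp add: add_diff_inverse_ennreal)
      qed
    qed
    then show ?thesis using False by (simp add: dual_string_def add_mass_def)
  qed
qed

lemma dual_string_add_mass: "dual_string (add_mass m M) = delay m (dual_string M)"
proof
  fix y
  consider "y = \<infinity>" | "y < ennreal m" | "ennreal m \<le> y" "y \<noteq> \<infinity>" by force
  then show "dual_string (add_mass m M) y = delay m (dual_string M) y"
  proof cases
    case 1
    then show ?thesis by (simp add: dual_string_def delay_def)
  next
    case 2
    then have "{t. y < add_mass m M t} = UNIV"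
      by (auto simp: add_mass_def intro: less_le_trans)
    then show ?thesis using 2 by (auto simp: dual_string_def delay_def bot_ennreal)
  next
    case 3
    have "y - ennreal m < \<infinity>" using 3 by (subst ennreal_diff_less_iff) (auto simp: less_top[symmetric])
    then show ?thesis using 3
      by (auto simp: dual_string_def delay_def add_mass_def ennreal_diff_less_iff)
  qed
qed

lemma dual_string_empty: "dual_string empty_string = (\<lambda>_. \<infinity>)"
proof
  fix y
  have "{t. y < empty_string t} = {\<infinity>}" if "y \<noteq> \<infinity>"
    using that by (auto simp: empty_string_def less_top[symmetric])
  then show "dual_string empty_string y = \<infinity>" by (simp add: dual_string_def)
qed

lemma dual_string_top: "dual_string (\<lambda>_. \<infinity>) = empty_string"
  by (auto simp: fun_eq_iff dual_string_def empty_string_def less_top[symmetric] bot_ennreal)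

lemma dual_bead_string: "dual_string (bead_string b r) = bead_string (\<not> b) r"
  using dual_string_top
  by (induction b r rule: bead_string.induct)
     (simp_all add: dual_string_empty dual_string_delay dual_string_add_mass)

lemma bead_value_gap_first_pos: "all_positive r \<Longrightarrow> bead_value True r \<mu> > 0"
  by (cases r) (auto simp: add_pos_nonneg)

text \<open>Reading the list with the opposite flag moves the factor \<open>\<mu>\<close> from the masses to the gaps.\<close>

lemma bead_value_dual:
  assumes "all_positive r" "\<mu> > 0"
  shows "bead_value (\<not> b) r \<mu> = inverse (ennreal \<mu> * bead_value b r \<mu>)"
  using assms
proof (induction b r rule: bead_string.induct)
  case 1
  then show ?case by (simp add: ennreal_mult_top)
next
  case (2 l r)
  have "ennreal (\<mu> * l) = ennreal \<mu> * ennreal l" using 2 by (simp add: ennreal_mult)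
  then show ?case using 2 by (simp add: distrib_left)
next
  case 3
  then show ?case by simp
next
  case (4 m r)
  have "ennreal \<mu> * inverse (ennreal \<mu>) = 1"
    using 4(3) by (simp add: inverse_ennreal flip: ennreal_mult)
  moreover have "ennreal (\<mu> * m) = ennreal \<mu> * ennreal m" using 4 by (simp add: ennreal_mult)
  ultimately have "inverse (ennreal \<mu>) * ennreal (\<mu> * m) = ennreal m"
    by (metis mult.commute mult.left_neutral mult.assoc)
  moreover have "inverse (ennreal \<mu> * x) = inverse (ennreal \<mu>) * inverse x" for x
    using 4(3) by (intro ennreal_inverse_mult') auto
  ultimately show ?case using 4 by (simp add: distrib_left)
qed

section \<open>The change of variables\<close>

text \<open>The effect of \<open>x = \<integral> (1 + s N)\<^sup>2\<close> and \<open>N \<mapsto> N / (1 + s N)\<close> on the list of \<open>N\<close>, where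
  \<open>p\<close> is the current value of \<open>1 + s N\<close>. A gap is stretched by \<open>p\<^sup>2\<close>. A mass \<open>m\<close>, which raises \<open>N\<close> from
  \<open>n\<close> to \<open>n + m\<close>, contributes the difference \<open>m / (p (p + s m))\<close> of the fractions. When \<open>N\<close> jumps to
  \<open>\<infinity>\<close>, the fraction jumps by \<open>1 / s - n / p = 1 / (s p)\<close> and stays there; for \<open>s = 0\<close> it jumps to
  \<open>\<infinity>\<close> as well.\<close>

fun rescale :: "real \<Rightarrow> bool \<Rightarrow> real \<Rightarrow> real list \<Rightarrow> real list" where
  "rescale s True p [] = []"
| "rescale s True p (l # r) = l * p\<^sup>2 # rescale s False p r"
| "rescale s False p [] = (if s = 0 then [] else [1 / (s * p)])"
| "rescale s False p (m # r) = m / (p * (p + s * m)) # rescale s True (p + s * m) r"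

lemma all_positive_rescale:
  assumes "all_positive r" "s \<ge> 0" "p > 0"
  shows "all_positive (rescale s b p r)"
  using assms
proof (induction s b p r rule: rescale.induct)
  case (2 s p l r)
  have "all_positive (rescale s False p r)" by (rule 2(1)) (use 2(2-) in auto)
  moreover have "l * p\<^sup>2 > 0" using 2(2,4) by simp
  ultimately show ?case unfolding rescale.simps by simp
next
  case (3 s p)
  then have "s = 0 \<or> s * p > 0" by (cases "s = 0") auto
  then show ?case unfolding rescale.simps by auto
next
  case (4 s p m r)
  have m: "m > 0" using 4(2) by simp
  have q: "p + s * m > 0" using 4(3,4) m by (intro add_pos_nonneg mult_nonneg_nonneg) auto
  have "all_positive (rescale s True (p + s * m) r)" by (rule 4(1)) (use 4(2,3) q in auto)
  moreover have "m / (p * (p + s * m)) > 0" using m q 4(4) by (intro divide_pos_pos mult_pos_pos)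
  ultimately show ?case unfolding rescale.simps by simp
qed simp

text \<open>The case \<open>p = 1\<close> is the aim: the change of variables adds \<open>s / \<mu>\<close>. For a tail of the list, which
  sees \<open>1 + s N\<close> starting at \<open>p\<close>, the affine map \<open>w \<mapsto> p\<^sup>2 w + s p / \<mu>\<close> is compatible with prefixing
  a gap and with prefixing a mass, where \<open>p\<close> changes to \<open>q = p + s m\<close>.\<close>

lemma bead_value_rescale:
  assumes "all_positive r" "s \<ge> 0" "p > 0" "\<mu> > 0"
  shows "bead_value b (rescale s b p r) \<mu> = ennreal (p\<^sup>2) * bead_value b r \<mu> + ennreal (s * p / \<mu>)"
  using assms
proof (induction s b p r rule: rescale.induct)
  case (1 s p)
  then show ?case by (simp add: ennreal_mult_top)
next
  case (2 s p l r)
  have "ennreal (l * p\<^sup>2) = ennreal (p\<^sup>2) * ennreal l"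
    using 2 by (simp add: ennreal_mult mult.commute)
  then show ?case using 2 by (simp add: distrib_left add.assoc)
next
  case (3 s p)
  then show ?case by (auto simp: inverse_ennreal field_simps)
next
  case (4 s p m r)
  define q where "q = p + s * m"
  have q: "q > 0" using 4 by (simp add: q_def add_pos_nonneg)
  have m: "m > 0" using 4 by simp
  have IH: "bead_value True (rescale s True q r) \<mu> = ennreal (q\<^sup>2) * bead_value True r \<mu> + ennreal (s * q / \<mu>)"
    using 4 q by (simp add: q_def)
  have "inverse (ennreal (\<mu> * (m / (p * q))) + inverse (ennreal (q\<^sup>2) * w + ennreal (s * q / \<mu>)))
     = ennreal (p\<^sup>2) * inverse (ennreal (\<mu> * m) + inverse w) + ennreal (s * p / \<mu>)" if "w > 0" for w
  proof (cases w)
    case (real w')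
    then have w': "w' > 0" using that by simp
    have 1: "q\<^sup>2 * w' + s * q / \<mu> > 0" using w' q 4 by (simp add: add_pos_nonneg)
    have 2: "\<mu> * (m / (p * q)) + inverse (q\<^sup>2 * w' + s * q / \<mu>) > 0"
      using 1 m q 4 by (simp add: add_pos_nonneg)
    have 3: "\<mu> * m + inverse w' > 0" using w' m 4 by (simp add: add_pos_pos)
    have "inverse (ennreal (\<mu> * (m / (p * q))) + inverse (ennreal (q\<^sup>2) * w + ennreal (s * q / \<mu>)))
      = ennreal (inverse (\<mu> * (m / (p * q)) + inverse (q\<^sup>2 * w' + s * q / \<mu>)))"
      using 1 2 w' q m 4(3-5) real by (simp add: inverse_ennreal flip: ennreal_mult ennreal_plus)
    also have "inverse (\<mu> * (m / (p * q)) + inverse (q\<^sup>2 * w' + s * q / \<mu>))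
      = p\<^sup>2 * inverse (\<mu> * m + inverse w') + s * p / \<mu>"
    proof -
      have d: "q * w' * \<mu> + s > 0" "\<mu> * m * w' + 1 > 0"
        using w' q m 4(3-5) by (simp_all add: add_pos_nonneg add_nonneg_pos)
      have "q\<^sup>2 * w' + s * q / \<mu> = q * (q * w' * \<mu> + s) / \<mu>"
        using 4(5) by (simp add: field_simps power2_eq_square)
      moreover have "\<mu> * (m / (p * q)) + \<mu> / (q * (q * w' * \<mu> + s))
        = \<mu> * (m * (q * w' * \<mu> + s) + p) / (p * q * (q * w' * \<mu> + s))"
        using d q 4(4) by (simp add: divide_simps) (simp add: algebra_simps)
      moreover have "m * (q * w' * \<mu> + s) + p = q * (\<mu> * m * w' + 1)"
        by (simp add: q_def algebra_simps)
      ultimately have "inverse (\<mu> * (m / (p * q)) + inverse (q\<^sup>2 * w' + s * q / \<mu>))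
        = p * (q * w' * \<mu> + s) / (\<mu> * (\<mu> * m * w' + 1))"
        using q d by simp
      also have "\<dots> = p\<^sup>2 * inverse (\<mu> * m + inverse w') + s * p / \<mu>"
      proof -
        have "\<mu> * m + inverse w' = (\<mu> * m * w' + 1) / w'" using w' by (simp add: field_simps)
        then have "p\<^sup>2 * inverse (\<mu> * m + inverse w') + s * p / \<mu>
          = p * (p * w' * \<mu> + s * (\<mu> * m * w' + 1)) / (\<mu> * (\<mu> * m * w' + 1))"
          using d w' 4(5) by (simp add: divide_simps power2_eq_square) (simp add: algebra_simps)
        moreover have "p * w' * \<mu> + s * (\<mu> * m * w' + 1) = q * w' * \<mu> + s"
          by (simp add: q_def algebra_simps)
        ultimately show ?thesis by simp
      qed
      finally show ?thesis .
    qed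
    also have "ennreal (p\<^sup>2 * inverse (\<mu> * m + inverse w') + s * p / \<mu>)
      = ennreal (p\<^sup>2) * inverse (ennreal (\<mu> * m) + inverse w) + ennreal (s * p / \<mu>)"
    proof -
      have "inverse (ennreal (\<mu> * m) + inverse w) = ennreal (inverse (\<mu> * m + inverse w'))"
        using 3 w' m 4(5) real by (simp add: inverse_ennreal flip: ennreal_plus)
      moreover have "ennreal (p\<^sup>2 * inverse (\<mu> * m + inverse w') + s * p / \<mu>)
        = ennreal (p\<^sup>2 * inverse (\<mu> * m + inverse w')) + ennreal (s * p / \<mu>)"
        using 3 4(3-5) by (intro ennreal_plus) auto
      moreover have "ennreal (p\<^sup>2 * inverse (\<mu> * m + inverse w'))
        = ennreal (p\<^sup>2) * ennreal (inverse (\<mu> * m + inverse w'))"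
        using 3 by (intro ennreal_mult) auto
      ultimately show ?thesis by (simp only:)
    qed
    finally show ?thesis .
  next
    case top
    have "inverse (\<mu> * (m / (p * q))) = p\<^sup>2 * inverse (\<mu> * m) + s * p / \<mu>"
      using q m 4(3-5) by (simp add: q_def field_simps power2_eq_square)
    then show ?thesis using top q m 4(3-5)
      by (simp add: ennreal_mult_top inverse_ennreal flip: ennreal_mult ennreal_plus)
  qed
  from this[OF bead_value_gap_first_pos[of r \<mu>]] show ?case
    using 4(2) unfolding rescale.simps bead_value.simps q_def[symmetric] IH by simp
qed

lemma time_changeI:
  assumes "t \<ge> 0" and above: "\<And>t'. t' > t \<Longrightarrow> ennreal x < time_integral s N t'"
    and below: "\<And>t'. 0 \<le> t' \<Longrightarrow> t' < t \<Longrightarrow> time_integral s N t' \<le> ennreal x"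
  shows "time_change s N x = ennreal t"
  unfolding time_change_def
proof (rule antisym)
  show "Inf {ennreal t' |t'. 0 \<le> t' \<and> ennreal x < time_integral s N t'} \<le> ennreal t"
  proof (rule ennreal_le_epsilon)
    fix e :: real assume "e > 0"
    then have "Inf {ennreal t' |t'. 0 \<le> t' \<and> ennreal x < time_integral s N t'} \<le> ennreal (t + e)"
      using assms(1) above[of "t + e"] by (intro Inf_lower CollectI exI[of _ "t + e"]) auto
    then show "Inf {ennreal t' |t'. 0 \<le> t' \<and> ennreal x < time_integral s N t'} \<le> ennreal t + ennreal e"
      using assms(1) \<open>e > 0\<close> by simp
  qed
  show "ennreal t \<le> Inf {ennreal t' |t'. 0 \<le> t' \<and> ennreal x < time_integral s N t'}"
    using below by (intro Inf_greatest) (force intro!: ennreal_leI simp: not_less[symmetric])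
qed

lemma measurable_bead_string [measurable]: "bead_string b r \<in> borel_measurable borel"
proof (induction b r rule: bead_string.induct)
  case 1
  show ?case unfolding bead_string.simps empty_string_def[abs_def] by measurable
next
  case (2 l r)
  note [measurable] = 2
  show ?case unfolding bead_string.simps delay_def[abs_def] by measurable
next
  case (4 m r)
  note [measurable] = 4
  show ?case unfolding bead_string.simps add_mass_def[abs_def] by measurable
qed simp

lemma time_integral_const:
  assumes "t \<ge> 0" "\<And>\<tau>. 0 \<le> \<tau> \<Longrightarrow> \<tau> < t \<Longrightarrow> N (ennreal \<tau>) = k"
  shows "time_integral s N t = (1 + ennreal s * k)\<^sup>2 * ennreal t"
proof -
  have "AE \<tau> in lborel. (1 + ennreal s * N (ennreal \<tau>))\<^sup>2 * indicator {0..t} \<tau>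
     = (1 + ennreal s * k)\<^sup>2 * indicator {0..t} \<tau>"
    using assms(2) by (intro AE_mp[OF AE_lborel_singleton[of t] AE_I2]) (auto simp: indicator_def)
  then show ?thesis
    unfolding time_integral_def using assms(1)
    by (subst nn_integral_cong_AE) (auto simp: nn_integral_cmult_indicator)
qed

lemma time_integral_delay:
  assumes [measurable]: "B \<in> borel_measurable borel" and l: "0 \<le> l" "l \<le> t"
  shows "time_integral s (add_mass n (delay l B)) t
    = (1 + ennreal s * ennreal n)\<^sup>2 * ennreal l + time_integral s (add_mass n B) (t - l)"
proof -
  let ?N = "add_mass n (delay l B)"
  have [measurable]: "delay l B \<in> borel_measurable borel" unfolding delay_def[abs_def] by measurable
  have [measurable]: "?N \<in> borel_measurable borel" unfolding add_mass_def[abs_def] by measurable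
  let ?f = "\<lambda>\<tau>. (1 + ennreal s * ?N (ennreal \<tau>))\<^sup>2"
  have "time_integral s ?N t = (\<integral>\<^sup>+\<tau>. ?f \<tau> * indicator {0..<l} \<tau> + ?f \<tau> * indicator {l..t} \<tau> \<partial>lborel)"
    unfolding time_integral_def using l by (intro nn_integral_cong) (auto simp: indicator_def)
  also have "\<dots> = (\<integral>\<^sup>+\<tau>. ?f \<tau> * indicator {0..<l} \<tau> \<partial>lborel) + (\<integral>\<^sup>+\<tau>. ?f \<tau> * indicator {l..t} \<tau> \<partial>lborel)"
    by (rule nn_integral_add) measurable
  also have "(\<integral>\<^sup>+\<tau>. ?f \<tau> * indicator {0..<l} \<tau> \<partial>lborel)
      = (\<integral>\<^sup>+\<tau>. (1 + ennreal s * ennreal n)\<^sup>2 * indicator {0..<l} \<tau> \<partial>lborel)"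
    by (intro nn_integral_cong) (auto simp: indicator_def add_mass_def delay_def ennreal_less_iff)
  also have "\<dots> = (1 + ennreal s * ennreal n)\<^sup>2 * ennreal l"
    using l by (subst nn_integral_cmult_indicator) auto
  also have "(\<integral>\<^sup>+\<tau>. ?f \<tau> * indicator {l..t} \<tau> \<partial>lborel)
      = (\<integral>\<^sup>+\<tau>. ?f (l + 1 * \<tau>) * indicator {l..t} (l + 1 * \<tau>) \<partial>lborel)"
    by (subst nn_integral_real_affine[where c=1 and t=l]) auto
  also have "\<dots> = time_integral s (add_mass n B) (t - l)"
    unfolding time_integral_def using l
    by (intro nn_integral_cong) (auto simp: indicator_def add_mass_def delay_def ennreal_less_iff)
  finally show ?thesis .
qed

lemma one_plus_mult_ennreal:
  assumes "s \<ge> 0" "n \<ge> 0"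
  shows "1 + ennreal s * ennreal n = ennreal (1 + s * n)"
proof -
  have "ennreal (1 + s * n) = ennreal 1 + ennreal (s * n)" using assms by (intro ennreal_plus) auto
  then show ?thesis using assms by (simp add: ennreal_mult)
qed

lemma string_fraction_finite:
  assumes "s \<ge> 0" "n \<ge> 0"
  shows "string_fraction s (ennreal n) = ennreal (n / (1 + s * n))"
proof -
  have "1 + s * n > 0" using assms by (simp add: add_pos_nonneg)
  then show ?thesis
    using assms unfolding string_fraction_def one_plus_mult_ennreal[OF assms]
    by (simp add: divide_ennreal del: ennreal_plus)
qed

text \<open>The induction on the list needs the tails of \<open>N\<close>, that is, the strings \<open>n + B\<close> where \<open>n\<close> is the mass
  collected so far and \<open>B\<close> is the bead string of the remaining list. Removing a gap shifts both \<open>x\<close>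
  and \<open>t\<close>; removing a mass only adds it to \<open>n\<close>.\<close>

lemma time_change_bead_string:
  assumes "all_positive r" "s \<ge> 0" "n \<ge> 0" "p = 1 + s * n" "x \<ge> 0"
  shows "\<exists>t\<ge>0. (\<forall>t'>t. ennreal x < time_integral s (add_mass n (bead_string b r)) t')
    \<and> (\<forall>t'. 0 \<le> t' \<longrightarrow> t' < t \<longrightarrow> time_integral s (add_mass n (bead_string b r)) t' \<le> ennreal x)
    \<and> add_mass (n / p) (bead_string b (rescale s b p r)) (ennreal x)
       = string_fraction s (add_mass n (bead_string b r) (ennreal t))"
  using assms
proof (induction s b p r arbitrary: n x rule: rescale.induct)
  case (1 s p)
  have p: "p > 0" using 1 by (simp add: add_pos_nonneg)
  have sq: "(1 + ennreal s * ennreal n)\<^sup>2 = ennreal (p\<^sup>2)"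
    using 1(2-4) unfolding one_plus_mult_ennreal[OF 1(2,3)]
    by (simp add: ennreal_power del: ennreal_plus)
  have TI: "time_integral s (add_mass n empty_string) t' = ennreal (p\<^sup>2 * t')" if "t' \<ge> 0" for t'
    using that by (subst time_integral_const[where k="ennreal n"])
      (auto simp: add_mass_def empty_string_def sq ennreal_mult)
  have "ennreal x < time_integral s (add_mass n empty_string) t'" if "t' > x / p\<^sup>2" for t'
  proof -
    have "t' > 0" using that 1 p by (meson divide_nonneg_pos le_less_trans zero_less_power)
    then show ?thesis using that p 1 by (simp add: TI ennreal_less_iff field_simps)
  qed
  moreover have "time_integral s (add_mass n empty_string) t' \<le> ennreal x" if "0 \<le> t'" "t' < x / p\<^sup>2" for t'
    using that p by (simp add: TI field_simps ennreal_leI)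
  moreover have "add_mass n empty_string (ennreal (x / p\<^sup>2)) = ennreal n"
    "add_mass (n / p) empty_string (ennreal x) = ennreal (n / p)"
    by (simp_all add: add_mass_def empty_string_def)
  ultimately show ?case
    using 1 p string_fraction_finite[of s n] by (intro exI[of _ "x / p\<^sup>2"]) auto
next
  case (2 s p l r)
  have p: "p > 0" using 2 by (simp add: add_pos_nonneg)
  have l: "l > 0" and r: "all_positive r" using 2 by auto
  let ?B = "bead_string False r"
  let ?N = "add_mass n (delay l ?B)"
  have sq: "(1 + ennreal s * ennreal n)\<^sup>2 = ennreal (p\<^sup>2)"
    using 2(3-5) unfolding one_plus_mult_ennreal[OF 2(3,4)]
    by (simp add: ennreal_power del: ennreal_plus)
  have early: "time_integral s ?N t' = ennreal (p\<^sup>2 * t')" if "0 \<le> t'" "t' \<le> l" for t'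
    using that by (subst time_integral_const[where k="ennreal n"])
      (auto simp: add_mass_def delay_def sq ennreal_mult ennreal_less_iff)
  have late: "time_integral s ?N t' = ennreal (p\<^sup>2 * l) + time_integral s (add_mass n ?B) (t' - l)"
    if "l \<le> t'" for t'
    using time_integral_delay[of ?B l t' s n] that l by (simp add: sq ennreal_mult)
  show ?case
  proof (cases "x < l * p\<^sup>2")
    case True
    define t where "t = x / p\<^sup>2"
    have t: "0 \<le> t" "t < l" "p\<^sup>2 * t = x" using True p 2 by (simp_all add: t_def field_simps)
    have "ennreal x < time_integral s ?N t'" if "t' > t" for t'
    proof (cases "t' \<le> l")
      case True
      have "x < p\<^sup>2 * t'" using that t p by (metis mult_strict_left_mono zero_less_power)
      then show ?thesis using early[of t'] that t True 2 by (simp add: ennreal_less_iff)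
    next
      case False
      have "ennreal x < ennreal (p\<^sup>2 * l)" using True 2 by (simp add: ennreal_less_iff mult.commute)
      also have "\<dots> \<le> time_integral s ?N t'" using late[of t'] False by simp
      finally show ?thesis .
    qed
    moreover have "time_integral s ?N t' \<le> ennreal x" if "0 \<le> t'" "t' < t" for t'
    proof -
      have "p\<^sup>2 * t' \<le> x" using that t p by (metis mult_left_mono less_imp_le zero_le_power)
      then show ?thesis using early[of t'] that t by (simp add: ennreal_leI)
    qed
    moreover have "?N (ennreal t) = ennreal n"
      using t by (simp add: add_mass_def delay_def ennreal_less_iff)
    moreover have "add_mass (n / p) (bead_string True (rescale s True p (l # r))) (ennreal x) = ennreal (n / p)"
      using True 2 by (simp add: add_mass_def delay_def ennreal_less_iff)
    ultimately show ?thesis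
      using 2 t string_fraction_finite[of s n] by (intro exI[of _ t]) auto
  next
    case False
    then have x: "0 \<le> x - l * p\<^sup>2" by simp
    obtain t where t: "t \<ge> 0"
      "\<And>t'. t' > t \<Longrightarrow> ennreal (x - l * p\<^sup>2) < time_integral s (add_mass n ?B) t'"
      "\<And>t'. 0 \<le> t' \<Longrightarrow> t' < t \<Longrightarrow> time_integral s (add_mass n ?B) t' \<le> ennreal (x - l * p\<^sup>2)"
      "add_mass (n / p) (bead_string False (rescale s False p r)) (ennreal (x - l * p\<^sup>2))
         = string_fraction s (add_mass n ?B (ennreal t))"
      using 2(1)[OF r 2(3-5) x] by blast
    have xsplit: "ennreal x = ennreal (p\<^sup>2 * l) + ennreal (x - l * p\<^sup>2)"
      using x l by (simp add: mult.commute flip: ennreal_plus)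
    have "ennreal x < time_integral s ?N t'" if "t' > l + t" for t'
      using late[of t'] t(2)[of "t' - l"] t(1) that unfolding xsplit
      by (simp add: ennreal_add_left_cancel_less)
    moreover have "time_integral s ?N t' \<le> ennreal x" if "0 \<le> t'" "t' < l + t" for t'
    proof (cases "t' \<le> l")
      case True
      have "p\<^sup>2 * t' \<le> p\<^sup>2 * l" using True by (intro mult_left_mono) auto
      then have "p\<^sup>2 * t' \<le> x" using x by (simp add: mult.commute)
      then show ?thesis using early[of t'] that True by (simp add: ennreal_leI)
    next
      case False
      then show ?thesis using late[of t'] t(3)[of "t' - l"] that unfolding xsplit
        by (simp add: add_left_mono)
    qed
    moreover have "?N (ennreal (l + t)) = add_mass n ?B (ennreal t)"
      using l t(1) by (simp add: add_mass_def delay_def ennreal_less_iff not_less flip: ennreal_plus)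
        (simp add: ennreal_minus)
    moreover have "add_mass (n / p) (bead_string True (rescale s True p (l # r))) (ennreal x)
      = add_mass (n / p) (bead_string False (rescale s False p r)) (ennreal (x - l * p\<^sup>2))"
      using False l 2(6) by (simp add: add_mass_def delay_def ennreal_less_iff ennreal_minus)
    ultimately show ?thesis
      using t(1,4) l by (intro exI[of _ "l + t"]) auto
  qed
next
  case (3 s p)
  have p: "p > 0" using 3 by (simp add: add_pos_nonneg)
  have N: "add_mass n (bead_string False []) = (\<lambda>_. \<infinity>)" by (simp add: add_mass_def fun_eq_iff)
  show ?case
  proof (cases "s = 0")
    case True
    have "time_integral s (\<lambda>_. \<infinity>) t' = ennreal t'" if "t' \<ge> 0" for t'
      using that True by (subst time_integral_const[where k=\<infinity>]) auto
    then show ?thesis using True 3 unfolding N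
      by (intro exI[of _ x]) (auto simp: add_mass_def string_fraction_def ennreal_less_iff ennreal_leI)
  next
    case False
    then have s: "s > 0" using 3 by simp
    have "time_integral s (\<lambda>_. \<infinity>) t' = \<infinity>" if "t' > 0" for t'
      using that s by (subst time_integral_const[where k=\<infinity>]) (auto simp: ennreal_mult_top ennreal_top_mult)
    moreover have "n / p + 1 / (s * p) = 1 / s"
    proof -
      have "n / p + 1 / (s * p) = (s * n + 1) / (s * p)" using s p by (simp add: add_divide_distrib)
      also have "s * n + 1 = p" using 3(4) by simp
      finally show ?thesis using p by simp
    qed
    then have "ennreal (n / p) + ennreal (1 / (s * p)) = ennreal (1 / s)"
      using s p 3(3) by (simp flip: ennreal_plus)
    ultimately show ?thesis using s unfolding N
      by (intro exI[of _ 0]) (auto simp: add_mass_def empty_string_def string_fraction_def)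
  qed
next
  case (4 s p m r)
  have p: "p > 0" using 4 by (simp add: add_pos_nonneg)
  have m: "m > 0" and r: "all_positive r" using 4 by auto
  have q: "p + s * m = 1 + s * (n + m)" using 4 by (simp add: algebra_simps)
  have q0: "p + s * m > 0" using p m 4 by (simp add: add_pos_nonneg)
  have merge: "add_mass a (add_mass b N) = add_mass (a + b) N" if "a \<ge> 0" "b \<ge> 0" for a b N
    using that by (simp add: fun_eq_iff add_mass_def add.assoc)
  have "n * (p + s * m) + m = (n + m) * p"
    using 4(5) by (simp add: algebra_simps)
  then have sum: "n / p + m / (p * (p + s * m)) = (n + m) / (p + s * m)"
    using p q0 by (simp add: divide_simps)
  have "add_mass (n / p) (bead_string False (rescale s False p (m # r)))
    = add_mass ((n + m) / (p + s * m)) (bead_string True (rescale s True (p + s * m) r))"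
    using merge[of "n / p" "m / (p * (p + s * m))"] p q0 m 4(4) sum by simp
  moreover have "add_mass n (bead_string False (m # r)) = add_mass (n + m) (bead_string True r)"
    using merge[of n m] m 4(4) by simp
  ultimately show ?case
    using 4(1)[OF r 4(3) _ q 4(6)] m 4(4) by simp
qed

lemma string_fraction_time_change_bead_string:
  assumes "all_positive r" "s \<ge> 0" "x \<ge> 0"
  shows "string_fraction s (bead_string b r (time_change s (bead_string b r) x))
    = bead_string b (rescale s b 1 r) (ennreal x)"
proof -
  have [simp]: "add_mass 0 N = N" for N by (simp add: add_mass_def fun_eq_iff)
  obtain t where "t \<ge> 0" "\<forall>t'>t. ennreal x < time_integral s (bead_string b r) t'"
    "\<forall>t'. 0 \<le> t' \<longrightarrow> t' < t \<longrightarrow> time_integral s (bead_string b r) t' \<le> ennreal x"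
    "bead_string b (rescale s b 1 r) (ennreal x) = string_fraction s (bead_string b r (ennreal t))"
    using time_change_bead_string[of r s 0 1 x b] assms by auto
  then show ?thesis using time_changeI[of t x s "bead_string b r"] by simp
qed

section \<open>The continued fractions\<close>

text \<open>Multiplication by \<open>-z\<close> exchanges the two kinds of levels of the continued fraction. This trades the
  two-step recursion of the definition for a one-step recursion with a factor \<open>-z\<close>.\<close>

lemma cont_frac_Cons:
  assumes "z \<noteq> 0" "xs \<noteq> []"
  shows "cont_frac (a # xs) z = of_real a / (- z) + 1 / (- z * cont_frac xs z)"
  using assms(2)
proof (induction xs arbitrary: a)
  case (Cons b ys)
  show ?case
  proof (cases ys)
    case Nil
    then show ?thesis using assms(1) by simp
  next
    case (Cons c cs)
    have "- z * cont_frac (b # c # cs) z = of_real b + 1 / cont_frac (c # cs) z"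
    proof -
      have "cont_frac (b # c # cs) z = of_real b / (- z) + 1 / (- z * cont_frac (c # cs) z)"
        using Cons.IH[of b] Cons by simp
      moreover have "- z * (of_real b / (- z)) = of_real b" using assms(1) by simp
      moreover have "- z * (1 / (- z * cont_frac (c # cs) z)) = 1 / cont_frac (c # cs) z"
        using assms(1) by simp
      ultimately show ?thesis by (simp only: distrib_left)
    qed
    then show ?thesis using Cons by (simp only: cont_frac.simps)
  qed
qed simp

lemma Re_complex_of_real_mult: "Re (complex_of_real a * w) = a * Re w"
  by simp

text \<open>Let \<open>e\<close> be the root of \<open>-z\<close> in the right half-plane and \<open>U = e W\<close>. The recursion for \<open>W\<close> becomes
  \<open>U = a / e + 1 / U'\<close>, and the right half-plane is closed under inversion and addition. In particular
  no denominator vanishes off \<open>[0,\<infinity>)\<close>.\<close>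

lemma cont_frac_half_plane:
  assumes e: "Re e > 0" "z = - (e\<^sup>2)" and "xs \<noteq> []" "\<forall>a\<in>set xs. 0 \<le> a" "last xs > 0"
  shows "Re (e * cont_frac xs z) > 0"
  using assms(3-5)
proof (induction xs)
  case (Cons a xs)
  have e0: "e \<noteq> 0" using e by auto
  have inv: "Re (1 / w) > 0" if "Re w > 0" for w :: complex
    using that by (auto simp: Re_divide_Reals complex_div_gt_0 Re_divide sum_power2_gt_zero_iff)
  have ae: "e * (of_real a / (- z)) = of_real a * (1 / e)"
    using e0 e(2) by (simp add: field_simps power2_eq_square)
  show ?case
  proof (cases "xs = []")
    case True
    have "Re (of_real a * (1 / e)) > 0"
      using Cons.prems True inv[OF e(1)] by (simp only: Re_complex_of_real_mult) simp
    then show ?thesis using True ae by simp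
  next
    case False
    then have IH: "Re (e * cont_frac xs z) > 0" using Cons by simp
    have "e * (1 / (- z * cont_frac xs z)) = 1 / (e * cont_frac xs z)"
      using e0 e(2) by (simp add: field_simps power2_eq_square)
    then have "e * cont_frac (a # xs) z = of_real a * (1 / e) + 1 / (e * cont_frac xs z)"
      using e0 e(2) ae by (subst cont_frac_Cons[OF _ False]) (simp_all add: distrib_left)
    moreover have "Re (of_real a * (1 / e)) \<ge> 0"
      using inv[OF e(1)] Cons.prems by (simp only: Re_complex_of_real_mult) simp
    ultimately show ?thesis using inv[OF IH] by simp
  qed
qed simp

lemma slit_plane_root:
  assumes "z \<in> - (complex_of_real ` {0..})"
  obtains e where "Re e > 0" "z = - (e\<^sup>2)"
proof -
  have "Re (csqrt (- z)) > 0"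
  proof (rule ccontr)
    assume "\<not> ?thesis"
    then have "Re (csqrt (- z)) = 0" using csqrt_principal[of "- z"] by auto
    then have "(csqrt (- z))\<^sup>2 = - of_real ((Im (csqrt (- z)))\<^sup>2)"
      by (simp add: complex_eq_iff power2_eq_square)
    then have "z = of_real ((Im (csqrt (- z)))\<^sup>2)" by simp
    then show False using assms by (metis ComplD atLeast_iff image_eqI zero_le_power2)
  qed
  then show ?thesis by (intro that[of "csqrt (- z)"]) auto
qed

lemma cont_frac_holomorphic:
  assumes "xs \<noteq> []" "\<forall>a\<in>set xs. 0 \<le> a" "last xs > 0"
  shows "cont_frac xs holomorphic_on (- (complex_of_real ` {0..}))"
  using assms
proof (induction xs)
  case (Cons a xs)
  let ?D = "- (complex_of_real ` {0..})"
  have z0: "z \<noteq> 0" if "z \<in> ?D" for z using that by auto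
  show ?case
  proof (cases "xs = []")
    case True
    have "(\<lambda>z. of_real a / (- z)) holomorphic_on ?D"
      using z0 by (intro holomorphic_intros) auto
    then show ?thesis using True by (simp add: fun_eq_iff cong: holomorphic_cong)
  next
    case False
    then have IH: "cont_frac xs holomorphic_on ?D" using Cons by simp
    have "cont_frac xs z \<noteq> 0" if "z \<in> ?D" for z
    proof -
      obtain e where e: "Re e > 0" "z = - (e\<^sup>2)" using slit_plane_root[OF \<open>z \<in> ?D\<close>] by blast
      have "Re (e * cont_frac xs z) > 0"
        using Cons.prems False by (intro cont_frac_half_plane[OF e]) auto
      then show ?thesis by auto
    qed
    then have "(\<lambda>z. of_real a / (- z) + 1 / (- z * cont_frac xs z)) holomorphic_on ?D"
      using z0 by (intro holomorphic_intros IH) auto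
    then show ?thesis
      using z0 cont_frac_Cons[OF _ False] by (subst holomorphic_cong[OF refl]) auto
  qed
qed simp

text \<open>The common values on the negative half-line are required to be positive real numbers, which is what
  links the complex continued fraction to the extended nonnegative value of the string.\<close>

definition bead_expansion :: "real list \<Rightarrow> bool \<Rightarrow> real list \<Rightarrow> bool" where
  "bead_expansion xs b r \<longleftrightarrow> all_positive r \<and> (\<forall>\<mu>>0. \<exists>g>0.
     cont_frac xs (complex_of_real (-\<mu>)) = complex_of_real g \<and> bead_value b r \<mu> = ennreal g)"

lemma bead_expansion_single:
  assumes "a > 0"
  shows "bead_expansion [a] False [1 / a]"
  unfolding bead_expansion_def
proof (intro conjI allI impI)
  fix \<mu> :: real assume "\<mu> > 0"
  then show "\<exists>g>0. cont_frac [a] (complex_of_real (-\<mu>)) = complex_of_real g \<and> bead_value False [1 / a] \<mu> = ennreal g"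
    using assms by (intro exI[of _ "a / \<mu>"]) (auto simp: inverse_ennreal)
qed (use assms in simp)

text \<open>One step of the theorem on lists: the dual string is obtained by negating the flag, and rescaling
  adds the term \<open>a / \<mu>\<close>.\<close>

lemma bead_expansion_Cons:
  assumes ex: "bead_expansion xs b r" and a: "a \<ge> 0" and ne: "xs \<noteq> []"
  shows "bead_expansion (a # xs) (\<not> b) (rescale a (\<not> b) 1 r)"
  unfolding bead_expansion_def
proof (intro conjI allI impI)
  have r: "all_positive r" using ex by (simp add: bead_expansion_def)
  show "all_positive (rescale a (\<not> b) 1 r)" by (rule all_positive_rescale[OF r a]) simp
  fix \<mu> :: real assume \<mu>: "\<mu> > 0"
  then obtain g where g: "g > 0" "cont_frac xs (complex_of_real (-\<mu>)) = complex_of_real g" "bead_value b r \<mu> = ennreal g"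
    using ex by (auto simp: bead_expansion_def)
  have "bead_value (\<not> b) (rescale a (\<not> b) 1 r) \<mu> = inverse (ennreal \<mu> * ennreal g) + ennreal (a / \<mu>)"
    using bead_value_rescale[OF r a, of 1 \<mu> "\<not> b"] bead_value_dual[OF r \<mu>, of b] \<mu> g by simp
  also have "\<dots> = ennreal (a / \<mu> + 1 / (\<mu> * g))"
    using \<mu> g a by (simp add: inverse_ennreal add.commute divide_inverse flip: ennreal_mult ennreal_plus)
  finally have val: "bead_value (\<not> b) (rescale a (\<not> b) 1 r) \<mu> = ennreal (a / \<mu> + 1 / (\<mu> * g))" .
  have "cont_frac (a # xs) (complex_of_real (-\<mu>)) = complex_of_real (a / \<mu> + 1 / (\<mu> * g))"
    using \<mu> g by (subst cont_frac_Cons[OF _ ne]) simp_all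
  moreover have "a / \<mu> + 1 / (\<mu> * g) > 0" using \<mu> g a by (simp add: add_nonneg_pos)
  ultimately show "\<exists>g>0. cont_frac (a # xs) (complex_of_real (-\<mu>)) = complex_of_real g
      \<and> bead_value (\<not> b) (rescale a (\<not> b) 1 r) \<mu> = ennreal g"
    using val by blast
qed

text \<open>The definite description needs both halves: the bead string has this characteristic
  function, and no other string has it.\<close>

lemma string_of_cont_frac:
  assumes ex: "bead_expansion xs b r" and xs: "xs \<noteq> []" "\<forall>a\<in>set xs. 0 \<le> a" "last xs > 0"
  shows "(THE M. krein_string M \<and> has_characteristic_function M (cont_frac xs)) = bead_string b r"
proof -
  have r: "all_positive r" using ex by (simp add: bead_expansion_def)
  obtain g where g: "\<And>\<mu>. \<mu> > 0 \<Longrightarrow> g \<mu> > 0 \<and> cont_frac xs (complex_of_real (-\<mu>)) = complex_of_real (g \<mu>)"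
    "\<And>\<mu>. \<mu> > 0 \<Longrightarrow> bead_value b r \<mu> = ennreal (g \<mu>)"
    using ex unfolding bead_expansion_def by metis
  have iff: "has_characteristic_function M (cont_frac xs) \<longleftrightarrow> (\<forall>\<mu>>0. characteristic_value M \<mu> (bead_value b r \<mu>))"
    if "krein_string M" for M
    using has_characteristic_function_iff[OF that cont_frac_holomorphic[OF xs] g(1)] g(2) by simp
  show ?thesis
  proof (rule the_equality)
    show "krein_string (bead_string b r) \<and> has_characteristic_function (bead_string b r) (cont_frac xs)"
      using iff krein_string_bead characteristic_value_bead[OF r] by auto
    show "M = bead_string b r" if "krein_string M \<and> has_characteristic_function M (cont_frac xs)" for M
      using that iff bead_string_unique[OF r, of M b] by blast
  qed
qed

lemma cf_string_eq_bead_string: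
  assumes s: "s 0 \<ge> 0" "\<And>j. j \<ge> 1 \<Longrightarrow> s j > 0" and k: "k > 0" and j: "j \<le> k"
    and ex: "bead_expansion (map s [j..<Suc k]) b r"
  shows "cf_string s j k = bead_string b r"
  unfolding cf_string_def
proof (rule string_of_cont_frac[OF ex])
  have "s i \<ge> 0" for i using s by (cases "i = 0") (auto simp: less_imp_le Suc_leI)
  then show "\<forall>a\<in>set (map s [j..<Suc k]). 0 \<le> a" by auto
  show "map s [j..<Suc k] \<noteq> []" using j by simp
  show "last (map s [j..<Suc k]) > 0" using s(2)[of k] k j by (simp add: last_map)
qed

lemma ex_bead_expansion:
  assumes s: "s 0 \<ge> 0" "\<And>j. j \<ge> 1 \<Longrightarrow> s j > 0" and k: "k > 0" and j: "j \<le> k"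
  shows "\<exists>b r. bead_expansion (map s [j..<Suc k]) b r"
  using j
proof (induction rule: inc_induct)
  case base
  then show ?case using bead_expansion_single[of "s k"] s(2)[of k] k by auto
next
  case (step n)
  have "s n \<ge> 0" using s by (cases "n = 0") (auto simp: less_imp_le Suc_leI)
  moreover have "map s [n..<Suc k] = s n # map s [Suc n..<Suc k]"
    using step by (subst upt_conv_Cons) auto
  ultimately show ?case
    using step bead_expansion_Cons[of "map s [Suc n..<Suc k]" _ _ "s n"] by (simp del: upt_Suc) blast
qed

theorem theorem3:
  fixes s :: "nat \<Rightarrow> real"
  assumes "s 0 \<ge> 0" and "\<And>j. j \<ge> 1 \<Longrightarrow> s j > 0"
  shows "\<forall>k>0.
    (\<forall>x::real. x \<ge> 0 \<longrightarrow> cf_string s k k (ennreal x) = ennreal (1 / s k)) \<and>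
    (\<forall>j<k. \<forall>x::real. x \<ge> 0 \<longrightarrow>
       (let N = dual_string (cf_string s (Suc j) k);
            t = time_change (s j) N x
        in cf_string s j k (ennreal x) = string_fraction (s j) (N t)))"
proof (intro allI impI conjI)
  fix k :: nat and x :: real assume k: "k > 0" and x: "x \<ge> 0"
  have "bead_expansion (map s [k..<Suc k]) False [1 / s k]"
    using bead_expansion_single[of "s k"] assms(2)[of k] k by simp
  then show "cf_string s k k (ennreal x) = ennreal (1 / s k)"
    using cf_string_eq_bead_string[of s k k, OF assms k] by (simp add: add_mass_def empty_string_def)
next
  fix k j :: nat and x :: real assume k: "k > 0" and j: "j < k" and x: "x \<ge> 0"
  have sj: "s j \<ge> 0" using assms by (cases "j = 0") (auto simp: less_imp_le Suc_leI)
  obtain b r where ex: "bead_expansion (map s [Suc j..<Suc k]) b r"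
    using ex_bead_expansion[of s k "Suc j", OF assms k] j by auto
  then have r: "all_positive r" by (simp add: bead_expansion_def)
  have "map s [j..<Suc k] = s j # map s [Suc j..<Suc k]"
    using j by (subst upt_conv_Cons) auto
  then have "bead_expansion (map s [j..<Suc k]) (\<not> b) (rescale (s j) (\<not> b) 1 r)"
    using bead_expansion_Cons[OF ex sj] j by simp
  then have "cf_string s j k = bead_string (\<not> b) (rescale (s j) (\<not> b) 1 r)"
    using cf_string_eq_bead_string[of s k j, OF assms k] j by simp
  moreover have "dual_string (cf_string s (Suc j) k) = bead_string (\<not> b) r"
    using cf_string_eq_bead_string[of s k "Suc j", OF assms k _ ex] j by (simp add: dual_bead_string)
  ultimately show "let N = dual_string (cf_string s (Suc j) k); t = time_change (s j) N x
        in cf_string s j k (ennreal x) = string_fraction (s j) (N t)"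
    using string_fraction_time_change_bead_string[OF r sj x] by (simp add: Let_def)
qed

end
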